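(* Let $B>0$ and let $f\in PW_B^2(\mathbb{R}^{n+1})$. Then for every $\mathbf{x}\in\mathbb{R}^{n+1}$, $$f(\mathbf{x})=\int_{\mathbb{R}}\mathscr{K}_{B,\mathbb{R}^{n+1}}(\mathbf{x},\xi)\,f(\xi)\,d\xi,\qquad\text{where}\quad \mathscr{K}_{B,\mathbb{R}^{n+1}}(\mathbf{x},\xi)=\frac{1}{2\pi}\int_{-B}^{B}e^{I_{\mathbf{x}}(\mathbf{x}-\xi)w}\,dw.$$
   Context: $\mathbb{R}_n$ is the real Clifford algebra generated by $\mathbf{e}_1,\dots,\mathbf{e}_n$ with $\mathbf{e}_r\mathbf{e}_s+\mathbf{e}_s\mathbf{e}_r=-2\delta_{rs}$; its elements are $a=\sum_A a_A\mathbf{e}_A$ ($a_A\in\mathbb{R}$, $A\subseteq\{1,\dots,n\}$ ordered, $\mathbf{e}_A$ the corresponding ordered product, $\mathbf{e}_\varnothing=1$), with norm $|a|=(\sum_A a_A^2)^{1/2}$. $\mathbb{R}^{n+1}$ is identified with the set of paravectors $\mathbf{x}=x_0+\underline{x}$, $\underline{x}=x_1\mathbf{e}_1+\dots+x_n\mathbf{e}_n$. $\mathbb{S}=\{\underline{x}:\ x_1^2+\dots+x_n^2=1\}$, so $I^2=-1$ for $I\in\mathbb{S}$; $L_I=\mathbb{R}+I\mathbb{R}\cong\mathbb{C}$. For nonreal $\mathbf{x}$, $I_{\mathbf{x}}=\underline{x}/|\underline{x}|\in\mathbb{S}$; for real $\mathbf{x}$, $I_{\mathbf{x}}$ may be any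 element of $\mathbb{S}$ (the kernel does not depend on the choice). For $U\subseteq\mathbb{R}^{n+1}$ open, a real differentiable $f:U\to\mathbb{R}_n$ is left slice monogenic, written $f\in\mathcal{SM}_l(U)$, if for every $I\in\mathbb{S}$, $\frac12\left(\frac{\partial}{\partial u}+I\frac{\partial}{\partial v}\right)f(u+Iv)=0$ on $U\cap L_I$. One-dimensional left-sided Clifford Fourier transform: for $I\in\mathbb{S}$ and $g\in L^1(\mathbb{R},\mathbb{R}_n)$, $\mathscr{F}_I(g)(w)=\frac{1}{\sqrt{2\pi}}\int_{\mathbb{R}}e^{-Iuw}g(u)\,du$, extended to $L^2(\mathbb{R},\mathbb{R}_n)$ by continuity (Plancherel). The slice monogenic Paley–Wiener space $PW_B^2(\mathbb{R}^{n+1})$ is the set of $f\in\mathcal{SM}_l(\mathbb{R}^{n+1})$ with $f|_{\mathbb{R}}\in L^2(\mathbb{R})$ and $\operatorname{supp}\mathscr{F}_I(f|_{\mathbb{R}})\subset[-B,B]$ for every $I\in\mathbb{S}$. *)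

theory Defs
  imports "HOL-Analysis.Analysis"
begin

section \<open>The real Clifford algebra with negative definite signature\<close>

text \<open>
  The generators are indexed by a finite linearly ordered type \<open>'n\<close>, so that \<open>n = CARD('n)\<close>.
  An element \<open>a = \<Sum>\<^sub>A a\<^sub>A e\<^sub>A\<close> is represented by the family \<open>coef a\<close> of its coefficients.
\<close>

typedef 'n clifford = "UNIV :: ('n set \<Rightarrow> real) set"
  morphisms coef Clifford ..

lemma coef_Clifford [simp]: "coef (Clifford f) = f"
  by (simp add: Clifford_inverse)

lemma clifford_eqI: "(\<And>A. coef a A = coef b A) \<Longrightarrow> a = b"
  by (metis coef_inject ext)

lemma clifford_eq_iff: "a = b \<longleftrightarrow> (\<forall>A. coef a A = coef b A)"
  by (auto intro: clifford_eqI)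

definition blade :: "'n set \<Rightarrow> 'n clifford" where
  "blade A = Clifford (\<lambda>B. if B = A then 1 else 0)"

abbreviation gen :: "'n \<Rightarrow> 'n clifford" where
  "gen i \<equiv> blade {i}"

lemma coef_blade: "coef (blade A) B = (if B = A then 1 else 0)"
  by (simp add: blade_def)

instantiation clifford :: (type) real_vector
begin

definition "0 = Clifford (\<lambda>A. 0)"
definition "a + b = Clifford (\<lambda>A. coef a A + coef b A)"
definition "- a = Clifford (\<lambda>A. - coef a A)"
definition "a - b = Clifford (\<lambda>A. coef a A - coef b A)"
definition "r *\<^sub>R a = Clifford (\<lambda>A. r * coef a A)"

instance
  by standard
     (auto simp: clifford_eq_iff zero_clifford_def plus_clifford_def uminus_clifford_def
        minus_clifford_def scaleR_clifford_def algebra_simps)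

end

lemma coef_vector_space [simp]:
  "coef 0 A = 0" "coef (a + b) A = coef a A + coef b A" "coef (- a) A = - coef a A"
  "coef (a - b) A = coef a A - coef b A" "coef (r *\<^sub>R a) A = r * coef a A"
  by (simp_all add: zero_clifford_def plus_clifford_def uminus_clifford_def
        minus_clifford_def scaleR_clifford_def)

lemma coef_sum [simp]: "coef (\<Sum>i\<in>I. f i) A = (\<Sum>i\<in>I. coef (f i) A)"
  by (induction I rule: infinite_finite_induct) simp_all

instantiation clifford :: (finite) euclidean_space
begin

definition "inner a b = (\<Sum>A\<in>UNIV. coef a A * coef b A)"
definition "norm (a :: 'a clifford) = sqrt (\<Sum>A\<in>UNIV. (coef a A)\<^sup>2)"
definition "sgn (a :: 'a clifford) = a /\<^sub>R norm a"
definition "dist (a :: 'a clifford) b = norm (a - b)"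
definition [code del]: "(uniformity :: ('a clifford \<times> 'a clifford) filter) =
  (INF e\<in>{0 <..}. principal {(x, y). dist x y < e})"
definition [code del]: "open (U :: 'a clifford set) =
  (\<forall>x\<in>U. eventually (\<lambda>(x', y). x' = x \<longrightarrow> y \<in> U) uniformity)"
definition "Basis = range (blade :: 'a set \<Rightarrow> 'a clifford)"

instance
proof
  fix a b c :: "'a clifford" and r :: real
  show "inner a b = inner b a"
    by (simp add: inner_clifford_def mult.commute)
  show "inner (a + b) c = inner a c + inner b c"
    by (simp add: inner_clifford_def algebra_simps sum.distrib)
  show "inner (r *\<^sub>R a) b = r * inner a b"
    by (simp add: inner_clifford_def algebra_simps sum_distrib_left)
  show "0 \<le> inner a a"
    by (simp add: inner_clifford_def sum_nonneg)
  show "inner a a = 0 \<longleftrightarrow> a = 0"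
    by (simp add: inner_clifford_def clifford_eq_iff sum_nonneg_eq_0_iff)
  show "norm a = sqrt (inner a a)"
    by (simp add: inner_clifford_def norm_clifford_def power2_eq_square)
  show "(Basis :: 'a clifford set) \<noteq> {}" "finite (Basis :: 'a clifford set)"
    by (simp_all add: Basis_clifford_def)
  show "inner u v = (if u = v then 1 else 0)" if "u \<in> Basis" "v \<in> Basis" for u v :: "'a clifford"
  proof -
    obtain A B where [simp]: "u = blade A" "v = blade B"
      using \<open>u \<in> Basis\<close> \<open>v \<in> Basis\<close> by (auto simp: Basis_clifford_def)
    have "u = v \<longleftrightarrow> A = B"
      by (auto simp: clifford_eq_iff coef_blade split: if_splits)
    moreover have "inner u v = (\<Sum>C\<in>UNIV. if C = A then (if C = B then 1 else 0) else 0)"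
      unfolding inner_clifford_def by (rule sum.cong) (auto simp: coef_blade)
    ultimately show ?thesis by simp
  qed
  show "(\<forall>u\<in>Basis. inner a u = 0) \<longleftrightarrow> a = 0"
  proof -
    have "inner a (blade A) = coef a A" for A
    proof -
      have "inner a (blade A) = (\<Sum>C\<in>UNIV. if C = A then coef a C else 0)"
        unfolding inner_clifford_def by (rule sum.cong) (auto simp: coef_blade)
      then show ?thesis by simp
    qed
    then show ?thesis
      by (simp add: Basis_clifford_def clifford_eq_iff)
  qed
qed (simp_all add: sgn_clifford_def dist_clifford_def uniformity_clifford_def open_clifford_def)

end

text \<open>
  Sorting \<open>e\<^sub>A e\<^sub>B\<close> costs one sign for each pair \<open>a \<in> A\<close>, \<open>b \<in> B\<close> with \<open>b < a\<close>
  (anticommutation), and one for each common index (since \<open>e\<^sub>i\<^sup>2 = -1\<close>). What remains is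
  \<open>e\<^sub>C\<close> with \<open>C\<close> the symmetric difference of \<open>A\<close> and \<open>B\<close>.
\<close>

definition blade_sign :: "'n::linorder set \<Rightarrow> 'n set \<Rightarrow> real" where
  "blade_sign A B = (- 1) ^ card {(a, b). a \<in> A \<and> b \<in> B \<and> b \<le> a}"

lemma blade_sign_prod:
  fixes A B :: "'n::{finite,linorder} set"
  shows "blade_sign A B = (\<Prod>a\<in>A. \<Prod>b\<in>B. if b \<le> a then - 1 else 1)"
proof -
  have "(\<Prod>a\<in>A. \<Prod>b\<in>B. if b \<le> a then - 1 else 1 :: real)
      = (\<Prod>p\<in>A \<times> B. if snd p \<le> fst p then - 1 else 1)"
    by (simp add: prod.cartesian_product case_prod_unfold)
  also have "\<dots> = (\<Prod>p\<in>{p \<in> A \<times> B. snd p \<le> fst p}. - 1)"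
    by (rule prod.inter_filter [symmetric]) simp
  also have "{p \<in> A \<times> B. snd p \<le> fst p} = {(a, b). a \<in> A \<and> b \<in> B \<and> b \<le> a}"
    by auto
  finally show ?thesis
    by (simp add: blade_sign_def)
qed

lemma prod_sym_diff:
  fixes g :: "'a::finite \<Rightarrow> real"
  assumes "\<And>x. g x * g x = 1"
  shows "prod g (sym_diff A B) = prod g A * prod g B"
proof -
  have A: "prod g A = prod g (A - B) * prod g (A \<inter> B)"
    by (subst prod.union_disjoint [symmetric]) (auto intro: prod.cong)
  have B: "prod g B = prod g (B - A) * prod g (A \<inter> B)"
    by (subst prod.union_disjoint [symmetric]) (auto intro: prod.cong)
  have "prod g (A \<inter> B) * prod g (A \<inter> B) = 1"
    by (simp add: prod.distrib [symmetric] assms)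
  moreover have "prod g (sym_diff A B) = prod g (A - B) * prod g (B - A)"
    by (rule prod.union_disjoint) auto
  ultimately show ?thesis
    unfolding A B by (metis (no_types, lifting) mult.assoc mult.commute mult.right_neutral)
qed

lemma blade_sign_sym_diff:
  fixes A B C :: "'n::{finite,linorder} set"
  shows "blade_sign (sym_diff A B) C = blade_sign A C * blade_sign B C"
    and "blade_sign A (sym_diff B C) = blade_sign A B * blade_sign A C"
proof -
  show "blade_sign (sym_diff A B) C = blade_sign A C * blade_sign B C"
    unfolding blade_sign_prod
    by (rule prod_sym_diff) (auto simp: prod.distrib [symmetric] intro!: prod.neutral)
  have "(\<Prod>c\<in>sym_diff B C. if c \<le> a then - 1 else 1 :: real)
      = (\<Prod>c\<in>B. if c \<le> a then - 1 else 1) * (\<Prod>c\<in>C. if c \<le> a then - 1 else 1)" for a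
    by (rule prod_sym_diff) simp
  then show "blade_sign A (sym_diff B C) = blade_sign A B * blade_sign A C"
    unfolding blade_sign_prod by (simp add: prod.distrib)
qed

lemma if_sum_distrib:
  fixes r s :: real
  shows "(if P then r * (\<Sum>x\<in>X. \<Sum>y\<in>Y. if Q x y then f x y else 0) * s else 0)
     = (\<Sum>x\<in>X. \<Sum>y\<in>Y. if Q x y then (if P then r * f x y * s else 0) else 0)"
  by (cases P) (auto simp: sum_distrib_left sum_distrib_right intro!: sum.cong sum.neutral)

lemma if_sum_distrib':
  fixes r :: real
  shows "(if P then r * (\<Sum>x\<in>X. \<Sum>y\<in>Y. if Q x y then f x y else 0) else 0)
     = (\<Sum>x\<in>X. \<Sum>y\<in>Y. if Q x y then (if P then r * f x y else 0) else 0)"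
  by (cases P) (auto simp: sum_distrib_left intro!: sum.cong sum.neutral)

instantiation clifford :: ("{finite,linorder}") real_algebra_1
begin

definition "1 = (blade {} :: 'a clifford)"
definition "a * b = Clifford (\<lambda>C. \<Sum>A\<in>UNIV. \<Sum>B\<in>UNIV.
   if sym_diff A B = C then blade_sign A B * coef a A * coef b B else 0)"

instance
proof
  fix a b c :: "'a clifford" and r :: real
  have coef_mult: "coef (x * y) C = (\<Sum>A\<in>UNIV. \<Sum>B\<in>UNIV.
      if sym_diff A B = C then blade_sign A B * coef x A * coef y B else 0)"
    for x y :: "'a clifford" and C
    by (simp add: times_clifford_def)
  show "a * b * c = a * (b * c)"
  proof (rule clifford_eqI)
    fix D
    have assoc: "sym_diff A (sym_diff B C) = sym_diff (sym_diff A B) C" for A B C :: "'a set"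
      by auto
    have "coef (a * b * c) D = (\<Sum>X\<in>UNIV. \<Sum>C\<in>UNIV. \<Sum>A\<in>UNIV. \<Sum>B\<in>UNIV.
        if sym_diff A B = X then
          (if sym_diff X C = D then blade_sign X C * (blade_sign A B * coef a A * coef b B) * coef c C
           else 0) else 0)"
      unfolding coef_mult
      by (intro sum.cong refl if_sum_distrib)
    also have "\<dots> = (\<Sum>C\<in>UNIV. \<Sum>A\<in>UNIV. \<Sum>B\<in>UNIV. \<Sum>X\<in>UNIV.
        if sym_diff A B = X then
          (if sym_diff X C = D then blade_sign X C * (blade_sign A B * coef a A * coef b B) * coef c C
           else 0) else 0)"
      by (subst sum.swap, rule sum.cong [OF refl], subst sum.swap, rule sum.cong [OF refl],
          subst sum.swap, rule refl)
    also have "\<dots> = (\<Sum>C\<in>UNIV. \<Sum>A\<in>UNIV. \<Sum>B\<in>UNIV.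
        if sym_diff (sym_diff A B) C = D
        then blade_sign A C * blade_sign B C * blade_sign A B * coef a A * coef b B * coef c C else 0)"
      by (intro sum.cong refl) (simp add: blade_sign_sym_diff mult.assoc)
    also have "\<dots> = (\<Sum>A\<in>UNIV. \<Sum>B\<in>UNIV. \<Sum>C\<in>UNIV.
        if sym_diff (sym_diff A B) C = D
        then blade_sign A C * blade_sign B C * blade_sign A B * coef a A * coef b B * coef c C else 0)"
      by (subst sum.swap, rule sum.cong [OF refl], subst sum.swap, rule refl)
    finally have 1: "coef (a * b * c) D = \<dots>" .
    have "coef (a * (b * c)) D = (\<Sum>A\<in>UNIV. \<Sum>X\<in>UNIV. \<Sum>B\<in>UNIV. \<Sum>C\<in>UNIV.
        if sym_diff B C = X then
          (if sym_diff A X = D then blade_sign A X * coef a A * (blade_sign B C * coef b B * coef c C)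
           else 0) else 0)"
      unfolding coef_mult
      by (intro sum.cong refl if_sum_distrib')
    also have "\<dots> = (\<Sum>A\<in>UNIV. \<Sum>B\<in>UNIV. \<Sum>C\<in>UNIV. \<Sum>X\<in>UNIV.
        if sym_diff B C = X then
          (if sym_diff A X = D then blade_sign A X * coef a A * (blade_sign B C * coef b B * coef c C)
           else 0) else 0)"
      by (rule sum.cong [OF refl], subst sum.swap, rule sum.cong [OF refl],
          subst sum.swap, rule refl)
    also have "\<dots> = (\<Sum>A\<in>UNIV. \<Sum>B\<in>UNIV. \<Sum>C\<in>UNIV.
        if sym_diff A (sym_diff B C) = D
        then blade_sign A C * blade_sign B C * blade_sign A B * coef a A * coef b B * coef c C else 0)"
      by (intro sum.cong refl) (simp add: blade_sign_sym_diff mult_ac)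
    finally show "coef (a * b * c) D = coef (a * (b * c)) D"
      unfolding 1 assoc by (rule sym)
  qed
  show "1 * a = a"
  proof (rule clifford_eqI)
    fix C
    have "coef (1 * a) C = (\<Sum>A\<in>UNIV. \<Sum>B\<in>UNIV. if B = C then
        (if A = ({} :: 'a set) then coef a B else 0) else 0)"
      unfolding coef_mult one_clifford_def
      by (intro sum.cong refl) (auto simp: coef_blade blade_sign_def)
    then show "coef (1 * a) C = coef a C" by simp
  qed
  show "a * 1 = a"
  proof (rule clifford_eqI)
    fix C
    have "coef (a * 1) C = (\<Sum>A\<in>UNIV. \<Sum>B\<in>UNIV. if B = ({} :: 'a set) then
        (if A = C then coef a A else 0) else 0)"
      unfolding coef_mult one_clifford_def
      by (intro sum.cong refl) (auto simp: coef_blade blade_sign_def)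
    then show "coef (a * 1) C = coef a C" by simp
  qed
  show "(a + b) * c = a * c + b * c"
    by (rule clifford_eqI)
       (auto simp: coef_mult sum.distrib [symmetric] algebra_simps intro!: sum.cong)
  show "a * (b + c) = a * b + a * c"
    by (rule clifford_eqI)
       (auto simp: coef_mult sum.distrib [symmetric] algebra_simps intro!: sum.cong)
  show "r *\<^sub>R a * b = r *\<^sub>R (a * b)" "a * r *\<^sub>R b = r *\<^sub>R (a * b)"
    by (rule clifford_eqI, auto simp: coef_mult sum_distrib_left algebra_simps intro!: sum.cong)+
  show "(0 :: 'a clifford) \<noteq> 1"
    by (auto simp: one_clifford_def clifford_eq_iff coef_blade)
qed

end

lemma blade_mult:
  "blade A * blade B = blade_sign A B *\<^sub>R blade (sym_diff A B)"
  for A B :: "'n::{finite,linorder} set"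
proof (rule clifford_eqI)
  fix C
  have "coef (blade A * blade B) C = (\<Sum>A'\<in>UNIV. \<Sum>B'\<in>UNIV. if B' = B then
     (if A' = A then (if sym_diff A' B' = C then blade_sign A' B' else 0) else 0) else 0)"
    unfolding times_clifford_def coef_Clifford coef_blade by (intro sum.cong refl) simp
  also have "\<dots> = (if sym_diff A B = C then blade_sign A B else 0)"
    by simp
  finally show "coef (blade A * blade B) C = coef (blade_sign A B *\<^sub>R blade (sym_diff A B)) C"
    by (auto simp: coef_blade)
qed

lemma gen_anticommute:
  fixes r s :: "'n::{finite,linorder}"
  shows "gen r * gen s + gen s * gen r = (if r = s then - 2 else 0)"
proof -
  have *: "{(a, b). a \<in> {x} \<and> b \<in> {y} \<and> b \<le> a} = (if y \<le> x then {(x, y)} else {})" for x y :: 'n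
    by auto
  have sign: "blade_sign {x} {y} = (if y \<le> x then - 1 else 1)" for x y :: 'n
    unfolding blade_sign_def * by simp
  have comm: "sym_diff {r} {s} = sym_diff {s} {r}" by auto
  show ?thesis
  proof (cases "r = s")
    case True
    then have "gen r * gen s = - 1"
      by (simp add: blade_mult sign one_clifford_def)
    with True show ?thesis by simp
  next
    case False
    then show ?thesis
      using comm by (cases "r \<le> s") (auto simp: blade_mult sign)
  qed
qed

lemma blade_eq_prod_list:
  "blade A = prod_list (map gen (sorted_list_of_set A))" for A :: "'n::{finite,linorder} set"
proof (induction "card A" arbitrary: A)
  case 0
  then show ?case by (simp add: one_clifford_def)
next
  case (Suc k)
  then have ne: "A \<noteq> {}" by auto
  define m where "m = Min A"
  have m: "m \<in> A" "\<And>a. a \<in> A \<Longrightarrow> m \<le> a"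
    using ne by (auto simp: m_def)
  have empty: "{(a, b). a \<in> {m} \<and> b \<in> A - {m} \<and> b \<le> a} = {}"
    using m(2) by force
  have "blade_sign {m} (A - {m}) = 1"
    unfolding blade_sign_def empty by simp
  moreover have "sym_diff {m} (A - {m}) = A"
    using m(1) by auto
  ultimately have "gen m * blade (A - {m}) = blade A"
    by (simp add: blade_mult)
  moreover have "blade (A - {m}) = prod_list (map gen (sorted_list_of_set (A - {m})))"
    using Suc m(1) by (intro Suc.hyps(1)) simp
  ultimately show ?case
    using sorted_list_of_set_nonempty [of A] ne by (simp add: m_def)
qed

text \<open>
  The norm above is submultiplicative only up to a constant, so the class of the library function
  \<open>exp\<close> does not apply. The exponential is its power series.
\<close>

definition clifford_exp :: "'n::{finite,linorder} clifford \<Rightarrow> 'n clifford" where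
  "clifford_exp a = (\<Sum>k. a ^ k /\<^sub>R fact k)"

section \<open>Paravectors and slice monogenic functions\<close>

text \<open>
  \<open>\<real>\<^sup>n\<^sup>+\<^sup>1\<close> is the subspace of paravectors. A function on an open subset of it is a function on the
  algebra whose values outside that subset are irrelevant.
\<close>

definition paravectors :: "'n::{finite,linorder} clifford set" where
  "paravectors = {of_real x0 + (\<Sum>i\<in>UNIV. v i *\<^sub>R gen i) | x0 v. True}"

definition unit_vectors :: "'n::{finite,linorder} clifford set" where
  "unit_vectors = {(\<Sum>i\<in>UNIV. v i *\<^sub>R gen i) | v. (\<Sum>i\<in>UNIV. (v i)\<^sup>2) = 1}"

definition vector_part :: "'n::{finite,linorder} clifford \<Rightarrow> 'n clifford" where
  "vector_part x = (\<Sum>i\<in>UNIV. coef x {i} *\<^sub>R gen i)"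

text \<open>The admissible values of \<open>I\<^sub>x\<close>: unique for nonreal \<open>x\<close>, arbitrary for real \<open>x\<close>.\<close>

definition slice_units :: "'n::{finite,linorder} clifford \<Rightarrow> 'n clifford set" where
  "slice_units x =
     (if x \<in> \<real> then unit_vectors else {vector_part x /\<^sub>R norm (vector_part x)})"

text \<open>
  Differentiability on \<open>U\<close> is real differentiability relative to the space of paravectors, in which
  \<open>U\<close> is open. It ensures that the two partial derivatives exist.
\<close>

definition slice_monogenic ::
    "'n::{finite,linorder} clifford set \<Rightarrow> ('n clifford \<Rightarrow> 'n clifford) set" where
  "slice_monogenic U = {f. openin (top_of_set paravectors) U \<and> f differentiable_on U \<and>
     (\<forall>I\<in>unit_vectors. \<forall>u v. of_real u + I * of_real v \<in> U \<longrightarrow>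
        (vector_derivative (\<lambda>s. f (of_real s + I * of_real v)) (at u) +
         I * vector_derivative (\<lambda>t. f (of_real u + I * of_real t)) (at v)) /\<^sub>R 2 = 0)}"

section \<open>The Clifford Fourier transform and the Paley--Wiener space\<close>

definition square_integrable :: "(real \<Rightarrow> 'a::euclidean_space) \<Rightarrow> bool" where
  "square_integrable g \<longleftrightarrow>
     g \<in> borel_measurable lborel \<and> integrable lborel (\<lambda>t. (norm (g t))\<^sup>2)"

definition L2_tendsto :: "(nat \<Rightarrow> real \<Rightarrow> 'a::euclidean_space) \<Rightarrow> (real \<Rightarrow> 'a) \<Rightarrow> bool" where
  "L2_tendsto G g \<longleftrightarrow>
     (\<lambda>k. \<integral>\<^sup>+ t. ennreal ((norm (G k t - g t))\<^sup>2) \<partial>lborel) \<longlonglongrightarrow> 0"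

definition fourier ::
    "'n::{finite,linorder} clifford \<Rightarrow> (real \<Rightarrow> 'n clifford) \<Rightarrow> real \<Rightarrow> 'n clifford" where
  "fourier I g w = (1 / sqrt (2 * pi)) *\<^sub>R
     (\<integral>u. clifford_exp (- (I * of_real u * of_real w)) * g u \<partial>lborel)"

text \<open>
  \<open>h\<close> is a representative of the extension by continuity of the transform to \<open>g \<in> L\<^sup>2\<close>.
  By Plancherel's theorem it exists, is unique almost everywhere, and does not depend on the
  approximating sequence in \<open>L\<^sup>1 \<inter> L\<^sup>2\<close>.
\<close>

definition has_fourier_L2 ::
    "'n::{finite,linorder} clifford \<Rightarrow> (real \<Rightarrow> 'n clifford) \<Rightarrow> (real \<Rightarrow> 'n clifford) \<Rightarrow> bool" where
  "has_fourier_L2 I g h \<longleftrightarrow> square_integrable g \<and> square_integrable h \<and>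
     (\<exists>G. (\<forall>k. integrable lborel (G k) \<and> square_integrable (G k)) \<and>
          L2_tendsto G g \<and> L2_tendsto (\<lambda>k. fourier I (G k)) h)"

text \<open>The support of a class of functions modulo equality almost everywhere.\<close>

definition ess_support :: "(real \<Rightarrow> 'a::zero) \<Rightarrow> real set" where
  "ess_support h = - \<Union>{V. open V \<and> (AE w in lborel. w \<in> V \<longrightarrow> h w = 0)}"

definition paley_wiener :: "real \<Rightarrow> ('n::{finite,linorder} clifford \<Rightarrow> 'n clifford) set" where
  "paley_wiener B = {f \<in> slice_monogenic paravectors.
     square_integrable (\<lambda>t. f (of_real t)) \<and>
     (\<forall>I\<in>unit_vectors. \<exists>h. has_fourier_L2 I (\<lambda>t. f (of_real t)) h \<and> ess_support h \<subseteq> {- B..B})}"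

text \<open>The kernel at \<open>(x, \<xi>)\<close>, computed with \<open>I \<in> slice_units x\<close> in the role of \<open>I\<^sub>x\<close>.\<close>

definition pw_kernel ::
    "real \<Rightarrow> 'n::{finite,linorder} clifford \<Rightarrow> 'n clifford \<Rightarrow> real \<Rightarrow> 'n clifford" where
  "pw_kernel B I x \<xi> = (1 / (2 * pi)) *\<^sub>R
     (LINT w:{- B..B}|lborel. clifford_exp (I * (x - of_real \<xi>) * of_real w))"

end

theory Submission
  imports Defs "HOL-Probability.Probability" "HOL-Complex_Analysis.Complex_Analysis"
begin

text \<open>
  Fix \<open>x = u + I v\<close> with \<open>I = I\<^sub>x\<close>. Left multiplication by \<open>I\<close> has square \<open>-1\<close>, so it turns the Clifford
  algebra into a complex vector space, and for each blade \<open>A\<close> the map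
  \<open>a \<mapsto> a\<^sub>A - \<i> (I a)\<^sub>A\<close> (\<open>slice_coef\<close>) is complex linear with real part the coefficient \<open>a\<^sub>A\<close>.
  Along the slice \<open>\<real> + I \<real>\<close> these functionals turn \<open>f\<close> into entire functions, the left Clifford
  Fourier transform into the ordinary one, and multiplication by the kernel into
  multiplication by \<open>k(z) = 1/(2\<pi>) \<integral>\<^sub>-\<^sub>B\<^sup>B exp(\<i> z w) dw\<close> (\<open>sinc_kernel\<close>). So everything
  follows from the complex case \<open>paley_wiener_reproducing_complex\<close>: if \<open>G\<close> is entire,
  \<open>g = G\<restriction>\<real>\<close> is in \<open>L\<^sup>2\<close> and its transform \<open>h\<close> vanishes off \<open>[-B, B]\<close>, then
  \<open>G(z) = \<integral> k(z - \<xi>) g(\<xi>) d\<xi>\<close>.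

  For this, the multiplication formula \<open>\<integral> p h = \<integral> p\<^sup>^ g\<close> extends from \<open>L\<^sup>1\<close>, where it is Fubini's
  theorem, to \<open>g \<in> L\<^sup>2\<close> whenever \<open>p \<in> L\<^sup>1 \<inter> L\<^sup>2\<close> and \<open>p\<^sup>^ \<in> L\<^sup>2\<close>, by continuity of the
  \<open>L\<^sup>2\<close> pairing. It is applied to two families of weights \<open>p\<close>. Let \<open>P(z) = \<integral>\<^sub>-\<^sub>B\<^sup>B exp(\<i> z w) h(w) dw\<close>, an entire function.
  \<^item> For \<open>p(w) = exp(\<i> z w)\<close> on \<open>[-B, B]\<close> and \<open>0\<close> elsewhere, \<open>p\<^sup>^\<close> is \<open>\<surd>(2\<pi>) k(z - \<cdot>)\<close>, which is in \<open>L\<^sup>2\<close> because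
    it decays like \<open>1/\<bar>\<xi>\<bar>\<close>. Hence \<open>P(z) = \<surd>(2\<pi>) \<integral> k(z - \<xi>) g(\<xi>) d\<xi>\<close>.
  \<^item> For \<open>p(w) = exp(\<i> t w - s\<^sup>2 w\<^sup>2 / 2)\<close> with \<open>t\<close> real, \<open>p\<^sup>^\<close> is \<open>\<surd>(2\<pi>)\<close> times the normal density
    with mean \<open>t\<close> and deviation \<open>s\<close>. As \<open>s\<close> tends to \<open>0\<close>, the formula becomes
    \<open>P(t) = \<surd>(2\<pi>) g(t)\<close>, since \<open>g\<close> is continuous.

  The entire functions \<open>P\<close> and \<open>\<surd>(2\<pi>) G\<close> agree on the real line, hence everywhere, and the
  first item gives the claim.
\<close>

section \<open>The multiplication formula for square integrable functions\<close>

lemma square_integrable_mult_integrable: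
  fixes p g :: "real \<Rightarrow> complex"
  assumes "square_integrable p" "square_integrable g"
  shows "integrable lborel (\<lambda>t. p t * g t)"
proof (rule Bochner_Integration.integrable_bound)
  show "integrable lborel (\<lambda>t. (norm (p t))\<^sup>2 + (norm (g t))\<^sup>2)"
    using assms by (simp add: square_integrable_def)
  have [measurable]: "p \<in> borel_measurable lborel" "g \<in> borel_measurable lborel"
    using assms by (simp_all add: square_integrable_def)
  show "(\<lambda>t. p t * g t) \<in> borel_measurable lborel" by measurable
  have "norm (p t) * norm (g t) \<le> (norm (p t))\<^sup>2 + (norm (g t))\<^sup>2" for t
    using sum_squares_bound[of "norm (p t)" "norm (g t)"]
      mult_nonneg_nonneg[OF norm_ge_zero[of "p t"] norm_ge_zero[of "g t"]] by linarith
  then show "AE t in lborel. norm (p t * g t) \<le> norm ((norm (p t))\<^sup>2 + (norm (g t))\<^sup>2)"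
    by (auto simp: norm_mult)
qed

text \<open>
  Continuity of the \<open>L\<^sup>2\<close> pairing, by the Cauchy--Schwarz inequality for \<open>p\<close> and \<open>G k - g\<close>. Only the
  products \<open>p * G k\<close> are assumed integrable, so that \<open>G k\<close> can be the Fourier transform of an
  integrable function, which is bounded.
\<close>

lemma L2_tendsto_integral_mult:
  fixes p g :: "real \<Rightarrow> complex"
  assumes p: "square_integrable p" and g: "square_integrable g"
    and G: "\<And>k. G k \<in> borel_measurable lborel" "\<And>k. integrable lborel (\<lambda>t. p t * G k t)"
    and lim: "L2_tendsto G g"
  shows "(\<lambda>k. \<integral>t. p t * G k t \<partial>lborel) \<longlonglongrightarrow> (\<integral>t. p t * g t \<partial>lborel)"
proof -
  note [measurable] = G(1)
  have [measurable]: "p \<in> borel_measurable lborel" "g \<in> borel_measurable lborel"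
    using p g by (simp_all add: square_integrable_def)
  define C where "C = (\<integral>\<^sup>+t. ennreal ((norm (p t))\<^sup>2) \<partial>lborel)"
  define D where "D k = (\<integral>\<^sup>+t. ennreal ((norm (G k t - g t))\<^sup>2) \<partial>lborel)" for k
  define E where "E k = ennreal (norm ((\<integral>t. p t * G k t \<partial>lborel) - (\<integral>t. p t * g t \<partial>lborel)))" for k
  have C: "C < \<infinity>"
    using p unfolding C_def square_integrable_def integrable_iff_bounded by auto
  have "E k \<le> (\<integral>\<^sup>+t. ennreal (norm (p t)) * ennreal (norm (G k t - g t)) \<partial>lborel)" for k
  proof -
    have "(\<integral>t. p t * G k t \<partial>lborel) - (\<integral>t. p t * g t \<partial>lborel)
        = (\<integral>t. p t * (G k t - g t) \<partial>lborel)"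
      using G(2)[of k] square_integrable_mult_integrable[OF p g] by (simp add: algebra_simps)
    moreover have "integrable lborel (\<lambda>t. p t * (G k t - g t))"
      using G(2)[of k] square_integrable_mult_integrable[OF p g] by (simp add: algebra_simps)
    ultimately show ?thesis
      unfolding E_def using integral_norm_bound_ennreal[of lborel "\<lambda>t. p t * (G k t - g t)"]
      by (simp add: norm_mult ennreal_mult)
  qed
  then have "(E k)\<^sup>2 \<le> (\<integral>\<^sup>+t. ennreal (norm (p t)) * ennreal (norm (G k t - g t)) \<partial>lborel)\<^sup>2" for k
    by (intro power_mono) auto
  also have "\<dots> k \<le> C * D k" for k
    unfolding C_def D_def
    using Cauchy_Schwarz_nn_integral[of "\<lambda>t. ennreal (norm (p t))" lborel "\<lambda>t. ennreal (norm (G k t - g t))"]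
    by (simp add: ennreal_power)
  finally have bound: "(E k)\<^sup>2 \<le> C * D k" for k .
  have "(\<lambda>k. C * D k) \<longlonglongrightarrow> C * 0"
    using lim C unfolding L2_tendsto_def D_def by (intro ennreal_tendsto_cmult) auto
  then have CD: "(\<lambda>k. C * D k) \<longlonglongrightarrow> 0" by simp
  have "(\<lambda>k. (E k)\<^sup>2) \<longlonglongrightarrow> 0"
    by (rule tendsto_sandwich[OF _ _ tendsto_const CD]) (simp_all add: bound)
  then have "(\<lambda>k. (norm ((\<integral>t. p t * G k t \<partial>lborel) - (\<integral>t. p t * g t \<partial>lborel)))\<^sup>2) \<longlonglongrightarrow> 0"
    unfolding E_def by (simp add: ennreal_power tendsto_ennreal_iff flip: ennreal_0)
  then have "(\<lambda>k. (\<integral>t. p t * G k t \<partial>lborel) - (\<integral>t. p t * g t \<partial>lborel)) \<longlonglongrightarrow> 0"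
    by (simp add: power_tendsto_0_iff tendsto_norm_zero_iff)
  then show ?thesis by (rule LIM_zero_cancel)
qed

definition fourier_integral :: "(real \<Rightarrow> complex) \<Rightarrow> real \<Rightarrow> complex" where
  "fourier_integral g w = (\<integral>u. exp (- (\<i> * of_real u * of_real w)) * g u \<partial>lborel) / sqrt (2 * pi)"

definition fourier_L2_pair :: "(real \<Rightarrow> complex) \<Rightarrow> (real \<Rightarrow> complex) \<Rightarrow> bool" where
  "fourier_L2_pair g h \<longleftrightarrow> square_integrable g \<and> square_integrable h \<and>
     (\<exists>G. (\<forall>k. integrable lborel (G k) \<and> square_integrable (G k)) \<and>
          L2_tendsto G g \<and> L2_tendsto (\<lambda>k. fourier_integral (G k)) h)"

lemma borel_measurable_fourier_integral [measurable]:
  assumes [measurable]: "g \<in> borel_measurable lborel"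
  shows "fourier_integral g \<in> borel_measurable lborel"
  unfolding fourier_integral_def by measurable

text \<open>The transform of an integrable function is bounded by its \<open>L\<^sup>1\<close> norm over \<open>\<surd>(2\<pi>)\<close>.\<close>

lemma integrable_mult_fourier_integral:
  assumes p: "integrable lborel p" and g: "integrable lborel g"
  shows "integrable lborel (\<lambda>w. p w * fourier_integral g w)"
proof (rule Bochner_Integration.integrable_bound)
  let ?C = "(\<integral>u. norm (g u) \<partial>lborel) / sqrt (2 * pi)"
  have [measurable]: "p \<in> borel_measurable lborel" "g \<in> borel_measurable lborel"
    using p g by auto
  show "integrable lborel (\<lambda>w. ?C * norm (p w))" using p by simp
  show "(\<lambda>w. p w * fourier_integral g w) \<in> borel_measurable lborel" by measurable
  have "norm (fourier_integral g w) \<le> ?C" for w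
    unfolding fourier_integral_def
    by (auto simp: norm_divide norm_mult intro!: divide_right_mono order_trans[OF integral_norm_bound])
  then have "norm (p w * fourier_integral g w) \<le> ?C * norm (p w)" for w
    using mult_right_mono[of "norm (fourier_integral g w)" ?C "norm (p w)"]
    by (simp add: norm_mult mult.commute)
  then show "AE w in lborel. norm (p w * fourier_integral g w) \<le> norm (?C * norm (p w))"
    by (intro AE_I2) (metis abs_ge_self order_trans real_norm_def)
qed

text \<open>
  Both sides are iterated integrals of \<open>exp(-\<i> u w) g(u) p(w)\<close>, whose modulus is the integrable
  function \<open>\<bar>g(u)\<bar> \<bar>p(w)\<bar>\<close>, so Fubini's theorem applies.
\<close>

lemma fourier_integral_multiplication_formula:
  assumes p: "integrable lborel p" and g: "integrable lborel g"
  shows "(\<integral>w. p w * fourier_integral g w \<partial>lborel) = (\<integral>u. fourier_integral p u * g u \<partial>lborel)"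
proof -
  let ?f = "\<lambda>u w. exp (- (\<i> * of_real u * of_real w)) * g u * p w"
  have [measurable]: "p \<in> borel_measurable lborel" "g \<in> borel_measurable lborel"
    using p g by auto
  have "integrable (lborel \<Otimes>\<^sub>M lborel) (case_prod ?f)"
  proof (rule lborel_pair.Fubini_integrable)
    show "integrable lborel (\<lambda>x. \<integral>y. norm (case_prod ?f (x, y)) \<partial>lborel)"
      using p g by (simp add: norm_mult)
    show "AE x in lborel. integrable lborel (\<lambda>y. case_prod ?f (x, y))"
    proof (intro AE_I2)
      fix x :: real
      show "integrable lborel (\<lambda>y. case_prod ?f (x, y))"
        by (rule Bochner_Integration.integrable_bound[of lborel "\<lambda>y. norm (g x) * norm (p y)"])
           (use p in \<open>auto simp: norm_mult\<close>)
    qed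
  qed measurable
  note Fub = lborel_pair.Fubini_integral[OF this]
  have 1: "p w * fourier_integral g w = (\<integral>u. ?f u w \<partial>lborel) / sqrt (2 * pi)" for w
    by (simp add: fourier_integral_def mult.commute[of "p w"])
  have "?f u w = exp (- (\<i> * of_real w * of_real u)) * p w * g u" for u w
    by (simp add: mult_ac)
  then have 2: "fourier_integral p u * g u = (\<integral>w. ?f u w \<partial>lborel) / sqrt (2 * pi)" for u
    by (simp only: fourier_integral_def integral_mult_left_zero times_divide_eq_left)
  show ?thesis
    unfolding 1 2 integral_divide_zero Fub ..
qed

text \<open>
  Each side depends continuously in \<open>L\<^sup>2\<close> on the approximating functions that define \<open>h\<close>, so the
  formula passes to the limit.
\<close>

lemma fourier_L2_pair_multiplication_formula:
  assumes gh: "fourier_L2_pair g h"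
    and p: "integrable lborel p" "square_integrable p" and q: "square_integrable (fourier_integral p)"
  shows "(\<integral>w. p w * h w \<partial>lborel) = (\<integral>u. fourier_integral p u * g u \<partial>lborel)"
proof -
  obtain G where G: "\<And>k. integrable lborel (G k)" "\<And>k. square_integrable (G k)"
    "L2_tendsto G g" "L2_tendsto (\<lambda>k. fourier_integral (G k)) h"
    using gh unfolding fourier_L2_pair_def by auto
  have "(\<lambda>k. \<integral>w. p w * fourier_integral (G k) w \<partial>lborel) \<longlonglongrightarrow> (\<integral>w. p w * h w \<partial>lborel)"
    using gh p G(1,4)
    by (intro L2_tendsto_integral_mult borel_measurable_fourier_integral integrable_mult_fourier_integral)
       (auto simp: fourier_L2_pair_def)
  moreover have "(\<lambda>k. \<integral>u. fourier_integral p u * G k u \<partial>lborel) \<longlonglongrightarrow> (\<integral>u. fourier_integral p u * g u \<partial>lborel)"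
    using gh p q G
    by (intro L2_tendsto_integral_mult square_integrable_mult_integrable)
       (auto simp: fourier_L2_pair_def)
  ultimately show ?thesis
    unfolding fourier_integral_multiplication_formula[OF p(1) G(1)] by (rule LIMSEQ_unique)
qed

section \<open>Gaussian summability\<close>

lemma integrable_gaussian:
  fixes c m :: real
  assumes "c > 0"
  shows "integrable lborel (\<lambda>w. exp (- c * (w - m)\<^sup>2))"
proof -
  have "integrable lborel (\<lambda>w. sqrt (pi / c) * normal_density m (1 / sqrt (2 * c)) w)"
    using assms by (intro integrable_mult_right integrable_normal_density) auto
  moreover have "sqrt (pi / c) * normal_density m (1 / sqrt (2 * c)) w = exp (- c * (w - m)\<^sup>2)" for w
    using assms by (simp add: normal_density_def field_simps)
  ultimately show ?thesis by simp
qed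

text \<open>
  An exponential with real frequency \<open>t\<close>, damped so as to be an admissible weight in the
  multiplication formula. As \<open>s\<close> tends to \<open>0\<close> the damping disappears.
\<close>

definition gaussian_wave :: "real \<Rightarrow> real \<Rightarrow> real \<Rightarrow> complex" where
  "gaussian_wave t s w = iexp (t * w) * of_real (exp (- (s * w)\<^sup>2 / 2))"

lemma norm_gaussian_wave: "norm (gaussian_wave t s w) = exp (- (s * w)\<^sup>2 / 2)"
  by (simp add: gaussian_wave_def norm_mult)

lemma borel_measurable_gaussian_wave [measurable]: "gaussian_wave t s \<in> borel_measurable borel"
  unfolding gaussian_wave_def by measurable

lemma integrable_gaussian_wave:
  assumes "s > 0"
  shows "integrable lborel (gaussian_wave t s)"
proof (rule Bochner_Integration.integrable_bound)
  show "integrable lborel (\<lambda>w. exp (- (s\<^sup>2 / 2) * (w - 0)\<^sup>2))"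
    using assms by (intro integrable_gaussian) simp
  show "AE w in lborel. norm (gaussian_wave t s w) \<le> norm (exp (- (s\<^sup>2 / 2) * (w - 0)\<^sup>2))"
    by (simp add: norm_gaussian_wave power_mult_distrib)
qed simp

lemma square_integrable_gaussian_wave:
  assumes "s > 0"
  shows "square_integrable (gaussian_wave t s)"
proof -
  have "(norm (gaussian_wave t s w))\<^sup>2 = exp (- (s\<^sup>2) * (w - 0)\<^sup>2)" for w
    by (simp add: norm_gaussian_wave power_mult_distrib flip: exp_double)
  then show ?thesis
    using assms integrable_gaussian[of "s\<^sup>2" 0] by (simp add: square_integrable_def)
qed

text \<open>
  The substitution \<open>w = y / s\<close> reduces the integral to the characteristic function of the
  standard normal distribution at \<open>(t - u) / s\<close>.
\<close>

lemma fourier_integral_gaussian_wave: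
  assumes s: "s > 0"
  shows "fourier_integral (gaussian_wave t s) u = of_real (sqrt (2 * pi) * normal_density t s u)"
proof -
  define r where "r = (t - u) / s"
  have "(\<integral>w. exp (- (\<i> * of_real w * of_real u)) * gaussian_wave t s w \<partial>lborel)
      = (\<integral>y. exp (- (\<i> * of_real (0 + 1 / s * y) * of_real u)) * gaussian_wave t s (0 + 1 / s * y) \<partial>lborel) / s"
    using s by (subst lborel_integral_real_affine[of "1 / s" _ 0]) (auto simp: scaleR_conv_of_real)
  also have "(\<lambda>y. exp (- (\<i> * of_real (0 + 1 / s * y) * of_real u)) * gaussian_wave t s (0 + 1 / s * y))
      = (\<lambda>y. of_real (sqrt (2 * pi)) * (std_normal_density y *\<^sub>R iexp (r * y)))"
  proof
    fix y
    have "exp (- (\<i> * of_real (0 + 1 / s * y) * of_real u)) * iexp (t * (0 + 1 / s * y)) = iexp (r * y)"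
      using s unfolding r_def exp_add[symmetric] by (simp add: field_simps)
    moreover have "s * (0 + 1 / s * y) = y" using s by simp
    ultimately have "exp (- (\<i> * of_real (0 + 1 / s * y) * of_real u)) * gaussian_wave t s (0 + 1 / s * y)
       = iexp (r * y) * of_real (exp (- y\<^sup>2 / 2))"
      unfolding gaussian_wave_def by (metis mult.assoc)
    also have "exp (- y\<^sup>2 / 2) = sqrt (2 * pi) * std_normal_density y"
      by (simp add: std_normal_density_def)
    finally show "exp (- (\<i> * of_real (0 + 1 / s * y) * of_real u)) * gaussian_wave t s (0 + 1 / s * y)
      = of_real (sqrt (2 * pi)) * (std_normal_density y *\<^sub>R iexp (r * y))"
      by (simp add: scaleR_conv_of_real mult_ac)
  qed
  also have "(\<integral>y. of_real (sqrt (2 * pi)) * (std_normal_density y *\<^sub>R iexp (r * y)) \<partial>lborel)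
      = of_real (sqrt (2 * pi)) * char std_normal_distribution r"
    unfolding integral_mult_right_zero by (simp add: char_def integral_density)
  also have "char std_normal_distribution r = of_real (exp (- r\<^sup>2 / 2))"
    by (simp add: char_std_normal_distribution)
  finally have "fourier_integral (gaussian_wave t s) u = of_real (exp (- r\<^sup>2 / 2) / s)"
    unfolding fourier_integral_def by simp
  also have "exp (- r\<^sup>2 / 2) / s = sqrt (2 * pi) * normal_density t s u"
    using s by (simp add: r_def normal_density_def real_sqrt_mult power_divide power2_commute)
  finally show ?thesis .
qed

lemma square_integrable_normal_density:
  assumes s: "s > 0"
  shows "square_integrable (\<lambda>u. complex_of_real (c * normal_density t s u))"
proof -
  have "(norm (complex_of_real (c * normal_density t s u)))\<^sup>2
      = c\<^sup>2 / (2 * pi * s\<^sup>2) * exp (- (1 / s\<^sup>2) * (u - t)\<^sup>2)" for u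
    unfolding norm_of_real
    by (simp add: normal_density_def power_mult_distrib power_divide flip: exp_double)
  then show ?thesis
    using s integrable_gaussian[of "1 / s\<^sup>2" t] by (simp add: square_integrable_def)
qed

text \<open>
  Since \<open>g\<close> is only square integrable, smallness of the density away from its mean \<open>t\<close> is needed
  together with a decay that can be integrated against \<open>g\<close>. Let \<open>x = (u - t)\<^sup>2\<close>. Half of the Gaussian
  exponent absorbs the normalising factor \<open>N\<close>, by \<open>N \<le> 1 + N\<^sup>2 / 4 \<le> exp(N\<^sup>2 x / 4)\<close> for \<open>x \<ge> 1\<close>; the other half,
  \<open>N\<^sup>2 x / 4\<close>, is at least \<open>N / 8 + x / 8\<close>.
\<close>

lemma normal_density_tail_bound:
  fixes N t u :: real
  assumes N: "N \<ge> 1" and u: "\<bar>u - t\<bar> \<ge> 1"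
  shows "normal_density t (1 / N) u \<le> exp (- N / 8) * exp (- (1 / 8) * (u - t)\<^sup>2)"
proof -
  define x where "x = (u - t)\<^sup>2"
  have x: "x \<ge> 1" using u by (simp add: x_def abs_le_square_iff[of 1, simplified])
  have N2: "N\<^sup>2 \<ge> N" using N by (simp add: power2_eq_square)
  have Nx: "N\<^sup>2 * x \<ge> N\<^sup>2" "N\<^sup>2 * x \<ge> x"
    using x N2 N mult_left_mono[of 1 x "N\<^sup>2"] mult_right_mono[of 1 "N\<^sup>2" x] by auto
  have "N \<le> 1 + N\<^sup>2 / 4"
    using zero_le_power2[of "N / 2 - 1"] by (simp add: power2_eq_square field_simps)
  also have "\<dots> \<le> 1 + N\<^sup>2 * x / 4" using Nx by simp
  also have "\<dots> \<le> exp (N\<^sup>2 * x / 4)" by (rule exp_ge_add_one_self)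
  finally have N_le: "N \<le> exp (N\<^sup>2 * x / 4)" .
  have "normal_density t (1 / N) u = N / sqrt (2 * pi) * exp (- (N\<^sup>2 * x / 2))"
    using N by (simp add: normal_density_def x_def real_sqrt_divide real_sqrt_mult field_simps)
  also have "\<dots> \<le> N * exp (- (N\<^sup>2 * x / 2))"
  proof (intro mult_right_mono)
    have "1 \<le> sqrt (2 * pi)" using pi_gt3 by (simp add: real_le_rsqrt)
    then show "N / sqrt (2 * pi) \<le> N" using N by (simp add: divide_le_eq mult_left_mono[of 1 _ N, simplified])
  qed simp
  also have "\<dots> \<le> exp (N\<^sup>2 * x / 4) * exp (- (N\<^sup>2 * x / 2))"
    by (intro mult_right_mono N_le) simp
  also have "\<dots> = exp (- (N\<^sup>2 * x / 4))"
    by (simp flip: exp_add)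
  also have "\<dots> \<le> exp (- N / 8 + - (1 / 8) * x)"
    using Nx N2 by simp
  finally show ?thesis
    by (simp only: exp_add x_def)
qed

text \<open>
  On \<open>[t - 1, t + 1]\<close> the function \<open>g\<close> is bounded, and after rescaling the density to the
  standard one dominated convergence applies. Outside this interval the tail bound makes the
  integral at most \<open>exp(-N/8)\<close> times a constant, where \<open>N = n + 1\<close>.
\<close>

lemma normal_density_approximate_identity:
  fixes g :: "real \<Rightarrow> complex"
  assumes cont: "continuous_on UNIV g" and g: "square_integrable g"
  shows "(\<lambda>n. \<integral>u. of_real (normal_density t (1 / real (Suc n)) u) * g u \<partial>lborel) \<longlonglongrightarrow> g t"
proof -
  let ?d = "\<lambda>n u. complex_of_real (normal_density t (1 / real (Suc n)) u)"
  let ?S = "cball t 1"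
  have [measurable]: "g \<in> borel_measurable borel"
    using g by (simp add: square_integrable_def)
  have int: "integrable lborel (\<lambda>u. ?d n u * g u)" for n
    using square_integrable_mult_integrable[OF square_integrable_normal_density[of _ 1] g, of "1 / real (Suc n)" t]
    by simp
  have near: "(\<lambda>n. \<integral>u. indicator ?S u *\<^sub>R (?d n u * g u) \<partial>lborel) \<longlonglongrightarrow> g t"
  proof -
    obtain M where M: "\<And>u. u \<in> ?S \<Longrightarrow> norm (g u) \<le> M"
      using compact_continuous_image[of ?S g] cont compact_imp_bounded
      by (metis bounded_iff compact_cball continuous_on_subset image_eqI subset_UNIV)
    have M0: "M \<ge> 0" using order_trans[OF norm_ge_zero M[of t]] by simp
    let ?f = "\<lambda>n y. indicator ?S (t + y / real (Suc n)) *\<^sub>R (of_real (std_normal_density y) * g (t + y / real (Suc n)))"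
    have [measurable]: "Measurable.pred borel (\<lambda>y. t + y / real (Suc n) \<in> ?S)" for n
      unfolding mem_cball dist_real_def by measurable
    have eq: "(\<integral>u. indicator ?S u *\<^sub>R (?d n u * g u) \<partial>lborel) = (\<integral>y. ?f n y \<partial>lborel)" for n
    proof -
      have *: "?d n (t + 1 / real (Suc n) * y) = complex_of_real (std_normal_density y) * complex_of_real (real (Suc n))" for y
      proof -
        have "normal_density t (1 / real (Suc n)) (t + 1 / real (Suc n) * y) = std_normal_density y * real (Suc n)"
          by (simp add: normal_density_def real_sqrt_divide real_sqrt_mult field_simps)
        then show ?thesis by (simp only: of_real_mult)
      qed
      have "(\<integral>u. indicator ?S u *\<^sub>R (?d n u * g u) \<partial>lborel)
        = (1 / real (Suc n)) *\<^sub>R (\<integral>y. indicator ?S (t + 1 / real (Suc n) * y) *\<^sub>R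
             (?d n (t + 1 / real (Suc n) * y) * g (t + 1 / real (Suc n) * y)) \<partial>lborel)"
        by (subst lborel_integral_real_affine[of "1 / real (Suc n)" _ t]) auto
      also have "\<dots> = (\<integral>y. ?f n y \<partial>lborel)"
        unfolding * integral_scaleR_right[symmetric]
        by (intro Bochner_Integration.integral_cong) (auto simp: scaleR_conv_of_real simp del: of_nat_Suc)
      finally show ?thesis .
    qed
    have "(\<lambda>n. \<integral>y. ?f n y \<partial>lborel) \<longlonglongrightarrow> (\<integral>y. of_real (std_normal_density y) * g t \<partial>lborel)"
    proof (rule integral_dominated_convergence)
      show "integrable lborel (\<lambda>y. std_normal_density y * M)" by simp
      show "AE y in lborel. norm (?f n y) \<le> std_normal_density y * M" for n
        using M M0 by (auto simp: norm_mult indicator_def intro!: mult_left_mono)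
      show "AE y in lborel. (\<lambda>n. ?f n y) \<longlonglongrightarrow> of_real (std_normal_density y) * g t"
      proof (intro AE_I2)
        fix y
        have lim: "(\<lambda>n. t + y / real (Suc n)) \<longlonglongrightarrow> t" by real_asymp
        then have "\<forall>\<^sub>F n in sequentially. t + y / real (Suc n) \<in> ball t 1"
          by (rule topological_tendstoD) auto
        then have ev: "\<forall>\<^sub>F n in sequentially. of_real (std_normal_density y) * g (t + y / real (Suc n)) = ?f n y"
          by eventually_elim (auto simp: indicator_def)
        have "isCont g t" using cont by (simp add: continuous_on_eq_continuous_at)
        then have "(\<lambda>n. g (t + y / real (Suc n))) \<longlonglongrightarrow> g t"
          using lim by (rule isCont_tendsto_compose)
        then have "(\<lambda>n. of_real (std_normal_density y) * g (t + y / real (Suc n))) \<longlonglongrightarrow> of_real (std_normal_density y) * g t"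
          by (rule tendsto_mult_left)
        then show "(\<lambda>n. ?f n y) \<longlonglongrightarrow> of_real (std_normal_density y) * g t"
          using ev by (rule Lim_transform_eventually)
      qed
    qed measurable
    also have "(\<integral>y. of_real (std_normal_density y) * g t \<partial>lborel) = g t"
      by (simp add: integral_complex_of_real)
    finally show ?thesis unfolding eq .
  qed
  have far: "(\<lambda>n. \<integral>u. indicator (- ?S) u *\<^sub>R (?d n u * g u) \<partial>lborel) \<longlonglongrightarrow> 0"
  proof -
    let ?e = "\<lambda>u. exp (- (1 / 8) * (u - t)\<^sup>2)"
    have "square_integrable (\<lambda>u. complex_of_real (?e u))"
      using integrable_gaussian[of "1 / 4" t] by (simp add: square_integrable_def flip: exp_double)
    from square_integrable_mult_integrable[OF this g]
    have e: "integrable lborel (\<lambda>u. ?e u * norm (g u))"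
      by (drule_tac integrable_norm) (simp add: norm_mult)
    have bound: "norm (\<integral>u. indicator (- ?S) u *\<^sub>R (?d n u * g u) \<partial>lborel)
       \<le> exp (- real (Suc n) / 8) * (\<integral>u. ?e u * norm (g u) \<partial>lborel)" for n
    proof -
      have "norm (\<integral>u. indicator (- ?S) u *\<^sub>R (?d n u * g u) \<partial>lborel)
         \<le> (\<integral>u. exp (- real (Suc n) / 8) * (?e u * norm (g u)) \<partial>lborel)"
      proof (rule Bochner_Integration.integral_norm_bound_integral)
        show "integrable lborel (\<lambda>u. indicator (- ?S) u *\<^sub>R (?d n u * g u))"
          by (intro integrable_mult_indicator int) simp
        show "integrable lborel (\<lambda>u. exp (- real (Suc n) / 8) * (?e u * norm (g u)))"
          by (intro integrable_mult_right e)
        show "norm (indicator (- ?S) u *\<^sub>R (?d n u * g u)) \<le> exp (- real (Suc n) / 8) * (?e u * norm (g u))" for u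
        proof (cases "u \<in> ?S")
          case False
          then have "normal_density t (1 / real (Suc n)) u \<le> exp (- real (Suc n) / 8) * ?e u"
            by (intro normal_density_tail_bound) (auto simp: dist_real_def)
          from mult_right_mono[OF this norm_ge_zero[of "g u"]] False
          show ?thesis by (simp add: norm_mult mult.assoc del: of_nat_Suc)
        qed simp
      qed
      then show ?thesis by (simp del: of_nat_Suc)
    qed
    have lim: "(\<lambda>n. exp (- real (Suc n) / 8)) \<longlonglongrightarrow> 0" by real_asymp
    show ?thesis
      by (rule Lim_null_comparison[OF always_eventually tendsto_mult_left_zero[OF lim]])
         (rule allI, rule bound)
  qed
  have "(\<integral>u. indicator ?S u *\<^sub>R (?d n u * g u) \<partial>lborel) + (\<integral>u. indicator (- ?S) u *\<^sub>R (?d n u * g u) \<partial>lborel)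
      = (\<integral>u. ?d n u * g u \<partial>lborel)" for n
  proof (subst Bochner_Integration.integral_add[symmetric])
    show "(\<integral>u. indicator ?S u *\<^sub>R (?d n u * g u) + indicator (- ?S) u *\<^sub>R (?d n u * g u) \<partial>lborel)
      = (\<integral>u. ?d n u * g u \<partial>lborel)"
      by (intro Bochner_Integration.integral_cong) (auto simp: indicator_def)
  qed (intro integrable_mult_indicator int; simp)+
  then show ?thesis
    using tendsto_add[OF near far] by simp
qed

section \<open>The reproducing formula for entire functions\<close>

definition truncated_exp :: "real \<Rightarrow> complex \<Rightarrow> real \<Rightarrow> complex" where
  "truncated_exp B z w = indicator {- B..B} w *\<^sub>R exp (\<i> * z * of_real w)"

text \<open>This is \<open>sin(B z) / (\<pi> z)\<close> for \<open>z \<noteq> 0\<close>, and \<open>B / \<pi>\<close> for \<open>z = 0\<close>, when \<open>B \<ge> 0\<close>.\<close>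

definition sinc_kernel :: "real \<Rightarrow> complex \<Rightarrow> complex" where
  "sinc_kernel B z = (\<integral>w. truncated_exp B z w \<partial>lborel) / (2 * pi)"

lemma borel_measurable_truncated_exp [measurable]: "truncated_exp B z \<in> borel_measurable borel"
  unfolding truncated_exp_def by measurable

lemma norm_exp_i_mult_le:
  assumes "\<bar>w\<bar> \<le> B"
  shows "norm (exp (\<i> * z * of_real w)) \<le> exp (B * \<bar>Im z\<bar>)"
proof -
  have "\<bar>Im z * w\<bar> \<le> B * \<bar>Im z\<bar>"
    using assms by (simp add: abs_mult mult.commute[of _ "\<bar>Im z\<bar>"] mult_left_mono)
  then show ?thesis by (simp add: abs_le_iff)
qed

lemma norm_truncated_exp_le:
  "norm (truncated_exp B z w) \<le> indicator {- B..B} w * exp (B * \<bar>Im z\<bar>)"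
  using norm_exp_i_mult_le[of w B z] by (auto simp: truncated_exp_def indicator_def)

lemma integrable_truncated_exp: "integrable lborel (truncated_exp B z)"
proof (rule Bochner_Integration.integrable_bound)
  show "integrable lborel (\<lambda>w. indicator {- B..B} w * exp (B * \<bar>Im z\<bar>))"
    by (intro integrable_mult_left integrable_real_indicator) (simp_all add: emeasure_lborel_Icc_eq)
  show "AE w in lborel. norm (truncated_exp B z w) \<le> norm (indicator {- B..B} w * exp (B * \<bar>Im z\<bar>))"
    using norm_truncated_exp_le[of B z] by simp
qed simp

lemma square_integrable_truncated_exp: "square_integrable (truncated_exp B z)"
  unfolding square_integrable_def
proof (intro conjI Bochner_Integration.integrable_bound[of lborel _ "\<lambda>t. (norm (truncated_exp B z t))\<^sup>2"])
  show "integrable lborel (\<lambda>w. indicator {- B..B} w * (exp (B * \<bar>Im z\<bar>))\<^sup>2)"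
    by (intro integrable_mult_left integrable_real_indicator) (simp_all add: emeasure_lborel_Icc_eq)
  show "AE w in lborel. norm ((norm (truncated_exp B z w))\<^sup>2) \<le> norm (indicator {- B..B} w * (exp (B * \<bar>Im z\<bar>))\<^sup>2)"
  proof (intro AE_I2)
    fix w
    have "(norm (truncated_exp B z w))\<^sup>2 \<le> (indicator {- B..B} w * exp (B * \<bar>Im z\<bar>))\<^sup>2"
      by (intro power_mono norm_truncated_exp_le norm_ge_zero)
    also have "\<dots> = indicator {- B..B} w * (exp (B * \<bar>Im z\<bar>))\<^sup>2"
      by (auto simp: indicator_def)
    finally show "norm ((norm (truncated_exp B z w))\<^sup>2) \<le> norm (indicator {- B..B} w * (exp (B * \<bar>Im z\<bar>))\<^sup>2)"
      by simp
  qed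
qed simp_all

lemma fourier_integral_truncated_exp:
  "fourier_integral (truncated_exp B z) u = sqrt (2 * pi) * sinc_kernel B (z - of_real u)"
proof -
  have "exp (- (\<i> * of_real w * of_real u)) * truncated_exp B z w = truncated_exp B (z - of_real u) w" for w
    by (simp add: truncated_exp_def mult_exp_exp algebra_simps)
  then have "fourier_integral (truncated_exp B z) u = (\<integral>w. truncated_exp B (z - of_real u) w \<partial>lborel) / sqrt (2 * pi)"
    by (simp add: fourier_integral_def)
  also have "\<dots> = sqrt (2 * pi) * sinc_kernel B (z - of_real u)"
  proof -
    have "complex_of_real (2 * pi) = of_real (sqrt (2 * pi)) * of_real (sqrt (2 * pi))"
      by (simp flip: of_real_mult)
    then show ?thesis unfolding sinc_kernel_def by (simp add: divide_simps)
  qed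
  finally show ?thesis .
qed

text \<open>
  The trivial bound \<open>2 B exp(B \<bar>Im z\<bar>)\<close> on the integral is combined with the bound
  \<open>2 exp(B \<bar>Im z\<bar>)\<close> on \<open>\<bar>z\<bar>\<close> times the integral, which comes from evaluating
  \<open>\<integral> \<i> z exp(\<i> z w) dw = exp(\<i> z B) - exp(-\<i> z B)\<close>.
\<close>

lemma integral_truncated_exp_decay:
  assumes "B > 0"
  shows "(1 + norm z) * norm (\<integral>w. truncated_exp B z w \<partial>lborel) \<le> 2 * (1 + B) * exp (B * \<bar>Im z\<bar>)"
proof -
  let ?J = "\<integral>w. truncated_exp B z w \<partial>lborel" and ?E = "exp (B * \<bar>Im z\<bar>)"
  have "norm ?J \<le> (\<integral>w. indicator {- B..B} w * ?E \<partial>lborel)"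
    by (rule Bochner_Integration.integral_norm_bound_integral[OF integrable_truncated_exp])
       (intro integrable_mult_left integrable_real_indicator norm_truncated_exp_le;
        simp add: emeasure_lborel_Icc_eq)+
  also have "\<dots> = 2 * B * ?E" using assms by simp
  finally have 1: "norm ?J \<le> 2 * B * ?E" .
  have "(\<integral>w. indicator {- B..B} w *\<^sub>R (\<i> * z * exp (\<i> * z * of_real w)) \<partial>lborel)
      = exp (\<i> * z * of_real B) - exp (\<i> * z * of_real (- B))"
  proof (rule integral_FTC_Icc)
    show "- B \<le> B" using assms by simp
    show "((\<lambda>w. exp (\<i> * z * of_real w)) has_vector_derivative \<i> * z * exp (\<i> * z * of_real w)) (at w within {- B..B})" for w
      by (rule has_vector_derivative_real_field) (auto intro!: derivative_eq_intros)
  qed (auto intro!: continuous_intros)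
  also have "(\<lambda>w. indicator {- B..B} w *\<^sub>R (\<i> * z * exp (\<i> * z * of_real w))) = (\<lambda>w. \<i> * z * truncated_exp B z w)"
    by (auto simp: truncated_exp_def scaleR_conv_of_real)
  finally have "\<i> * z * ?J = exp (\<i> * z * of_real B) - exp (\<i> * z * of_real (- B))"
    by simp
  then have "norm z * norm ?J = norm (exp (\<i> * z * of_real B) - exp (\<i> * z * of_real (- B)))"
    by (metis norm_ii norm_mult mult_1)
  also have "\<dots> \<le> ?E + ?E"
    using assms
    by (intro order_trans[OF norm_triangle_ineq4] add_mono norm_exp_i_mult_le) auto
  finally show ?thesis using 1 by (simp add: algebra_simps)
qed

lemma integrable_inverse_1_plus_square_shifted: "integrable lborel (\<lambda>u::real. inverse (1 + (u - x)\<^sup>2))"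
  using integrable_inverse_1_plus_square lborel_integrable_real_affine[of "\<lambda>u. inverse (1 + u\<^sup>2)" 1 "- x"]
  by (simp add: set_integrable_def einterval_def)

text \<open>
  By the preceding decay, the square of the transform at \<open>u\<close> is at most a constant over
  \<open>1 + (u - Re z)\<^sup>2\<close>.
\<close>

lemma square_integrable_fourier_truncated_exp:
  assumes "B > 0"
  shows "square_integrable (fourier_integral (truncated_exp B z))"
proof -
  let ?F = "fourier_integral (truncated_exp B z)"
  define C where "C = 2 * (1 + B) * exp (B * \<bar>Im z\<bar>)"
  have meas: "?F \<in> borel_measurable lborel"
    by (rule borel_measurable_fourier_integral) simp
  have bound: "(norm (?F u))\<^sup>2 \<le> C\<^sup>2 * inverse (1 + (u - Re z)\<^sup>2)" for u
  proof -
    let ?J = "\<integral>w. truncated_exp B (z - of_real u) w \<partial>lborel"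
    have "norm (?F u) = norm ?J / sqrt (2 * pi)"
      unfolding fourier_integral_truncated_exp sinc_kernel_def
      by (simp add: norm_mult norm_divide real_div_sqrt field_simps flip: real_sqrt_mult)
    also have "\<dots> \<le> norm ?J"
    proof -
      have "1 \<le> sqrt (2 * pi)" using pi_gt3 by (simp add: real_le_rsqrt)
      then show ?thesis using mult_left_mono[of 1 "sqrt (2 * pi)" "norm ?J"] by (simp add: divide_le_eq)
    qed
    finally have F: "norm (?F u) \<le> norm ?J" .
    have "(1 + \<bar>u - Re z\<bar>) * norm (?F u) \<le> (1 + norm (z - of_real u)) * norm ?J"
      using abs_Re_le_cmod[of "z - of_real u"] F
      by (intro mult_mono) auto
    also have "\<dots> \<le> C"
      using integral_truncated_exp_decay[OF assms, of "z - of_real u"] by (simp add: C_def)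
    finally have sq: "((1 + \<bar>u - Re z\<bar>) * norm (?F u))\<^sup>2 \<le> C\<^sup>2"
      by (rule power_mono) simp
    have "1 + (u - Re z)\<^sup>2 \<le> (1 + \<bar>u - Re z\<bar>)\<^sup>2"
      by (simp add: power2_eq_square algebra_simps abs_mult_self_eq)
    then have "(1 + (u - Re z)\<^sup>2) * (norm (?F u))\<^sup>2 \<le> (1 + \<bar>u - Re z\<bar>)\<^sup>2 * (norm (?F u))\<^sup>2"
      by (rule mult_right_mono) simp
    also have "\<dots> \<le> C\<^sup>2"
      using sq by (simp only: power_mult_distrib)
    finally have "(1 + (u - Re z)\<^sup>2) * (norm (?F u))\<^sup>2 \<le> C\<^sup>2" .
    moreover have "1 + (u - Re z)\<^sup>2 > 0" by (simp add: add_pos_nonneg)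
    ultimately show ?thesis by (simp add: field_simps)
  qed
  have "integrable lborel (\<lambda>u. (norm (?F u))\<^sup>2)"
  proof (rule Bochner_Integration.integrable_bound)
    show "integrable lborel (\<lambda>u. C\<^sup>2 * inverse (1 + (u - Re z)\<^sup>2))"
      by (intro integrable_mult_right integrable_inverse_1_plus_square_shifted)
    show "(\<lambda>u. (norm (?F u))\<^sup>2) \<in> borel_measurable lborel" using meas by measurable
    show "AE u in lborel. norm ((norm (?F u))\<^sup>2) \<le> norm (C\<^sup>2 * inverse (1 + (u - Re z)\<^sup>2))"
      using bound by (auto intro!: AE_I2 order_trans[OF bound])
  qed
  then show ?thesis using meas by (simp add: square_integrable_def)
qed

text \<open>
  The exponential series can be integrated term by term against \<open>H\<close>, because its terms are
  dominated by \<open>(B \<bar>z\<bar>)\<^sup>n / n! \<cdot> \<bar>H(w)\<bar>\<close>. This gives a power series with infinite radius of convergence.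
\<close>

lemma holomorphic_fourier_integral_compact_support:
  fixes H :: "real \<Rightarrow> complex"
  assumes H: "integrable lborel H" and supp: "\<And>w. \<bar>w\<bar> > B \<Longrightarrow> H w = 0" and B: "B \<ge> 0"
  shows "(\<lambda>z. \<integral>w. exp (\<i> * z * of_real w) * H w \<partial>lborel) holomorphic_on UNIV"
proof -
  have [measurable]: "H \<in> borel_measurable borel" using H by auto
  have "(\<lambda>n. (\<integral>w. (\<i> * of_real w) ^ n * H w / fact n \<partial>lborel) * (z - 0) ^ n) sums
      (\<integral>w. exp (\<i> * z * of_real w) * H w \<partial>lborel)" for z
  proof -
    let ?f = "\<lambda>n w. (\<i> * z * of_real w) ^ n / fact n * H w"
    have bound: "norm (?f n w) \<le> (B * norm z) ^ n / fact n * norm (H w)" for n w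
    proof (cases "\<bar>w\<bar> \<le> B")
      case True
      then have "(norm z * \<bar>w\<bar>) ^ n \<le> (B * norm z) ^ n"
        by (intro power_mono) (auto simp: mult.commute[of _ "norm z"] mult_left_mono)
      then show ?thesis by (auto simp: norm_mult norm_divide norm_power intro!: mult_right_mono divide_right_mono)
    qed (simp add: supp)
    have int: "integrable lborel (?f n)" for n
      by (rule Bochner_Integration.integrable_bound[of lborel "\<lambda>w. (B * norm z) ^ n / fact n * norm (H w)"])
         (use H bound order_trans[OF bound abs_ge_self] in \<open>auto simp del: times_divide_eq_left\<close>)
    have summ: "summable (\<lambda>n. (B * norm z) ^ n / fact n * c)" for c
      using summable_exp[of "B * norm z"] by (intro summable_mult2) (simp add: field_simps)
    have sm: "summable (\<lambda>n. norm (?f n w))" for w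
      by (rule summable_comparison_test'[OF summ[of "norm (H w)"]]) (use bound in simp)
    have "(\<lambda>n. \<integral>w. ?f n w \<partial>lborel) sums (\<integral>w. (\<Sum>n. ?f n w) \<partial>lborel)"
    proof (rule sums_integral[OF int])
      show "AE w in lborel. summable (\<lambda>n. norm (?f n w))" using sm by simp
      show "summable (\<lambda>n. \<integral>w. norm (?f n w) \<partial>lborel)"
      proof (rule summable_comparison_test'[OF summ[of "\<integral>w. norm (H w) \<partial>lborel"]])
        fix n
        have "(\<integral>w. norm (?f n w) \<partial>lborel) \<le> (\<integral>w. (B * norm z) ^ n / fact n * norm (H w) \<partial>lborel)"
          by (intro integral_mono integrable_norm int bound integrable_mult_right H)
        then show "norm (\<integral>w. norm (?f n w) \<partial>lborel) \<le> (B * norm z) ^ n / fact n * (\<integral>w. norm (H w) \<partial>lborel)"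
          by simp
      qed
    qed
    moreover have "(\<Sum>n. ?f n w) = exp (\<i> * z * of_real w) * H w" for w
    proof -
      have "(\<lambda>n. (\<i> * z * of_real w) ^ n /\<^sub>R fact n) sums exp (\<i> * z * of_real w)" by (rule exp_converges)
      then have "(\<lambda>n. (\<i> * z * of_real w) ^ n / fact n) sums exp (\<i> * z * of_real w)"
        by (simp add: scaleR_conv_of_real field_simps)
      from sums_mult2[OF this] show ?thesis by (simp add: sums_iff)
    qed
    moreover have "(\<integral>w. ?f n w \<partial>lborel) = (\<integral>w. (\<i> * of_real w) ^ n * H w / fact n \<partial>lborel) * (z - 0) ^ n" for n
      by (subst integral_mult_left_zero[symmetric]) (simp add: power_mult_distrib mult_ac)
    ultimately show ?thesis by simp
  qed
  then have hol: "(\<lambda>z. \<integral>w. exp (\<i> * z * of_real w) * H w \<partial>lborel) holomorphic_on ball 0 r" for r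
    by (rule power_series_holomorphic)
  have "(\<lambda>z. \<integral>w. exp (\<i> * z * of_real w) * H w \<partial>lborel) field_differentiable at z" for z
    by (rule holomorphic_on_imp_differentiable_at[OF hol[of "norm z + 1"] open_ball]) simp
  then show ?thesis by (simp add: holomorphic_on_def)
qed

text \<open>
  With \<open>P\<close> the entire function \<open>z \<mapsto> \<integral>\<^sub>-\<^sub>B\<^sup>B exp(\<i> z w) h(w) dw\<close>, Gaussian weights in the multiplication
  formula show that \<open>\<surd>(2\<pi>) G = P\<close> on the real line, and truncated exponentials identify \<open>P\<close>
  everywhere with \<open>\<surd>(2\<pi>)\<close> times the integral against the kernel.
\<close>

theorem paley_wiener_reproducing_complex:
  fixes G :: "complex \<Rightarrow> complex"
  assumes B: "B > 0" and G: "G holomorphic_on UNIV"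
    and pair: "fourier_L2_pair (\<lambda>t. G (of_real t)) h"
    and supp: "AE w in lborel. w \<notin> {- B..B} \<longrightarrow> h w = 0"
  shows "has_bochner_integral lborel (\<lambda>u. sinc_kernel B (z - of_real u) * G (of_real u)) (G z)"
proof -
  let ?g = "\<lambda>t::real. G (of_real t)"
  have g: "square_integrable ?g" and h: "square_integrable h"
    using pair by (auto simp: fourier_L2_pair_def)
  have hm [measurable]: "h \<in> borel_measurable borel" using h by (simp add: square_integrable_def)
  \<comment> \<open>At \<open>z = 0\<close> the truncated exponential is the indicator of \<open>[-B, B]\<close>, so \<open>H\<close> is the truncation
    of \<open>h\<close>; in this form its integrability is that of a product of two \<open>L\<^sup>2\<close> functions.\<close>
  define H where "H w = truncated_exp B 0 w * h w" for w
  define P where "P z = (\<integral>w. exp (\<i> * z * of_real w) * H w \<partial>lborel)" for z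
  have H: "integrable lborel H"
    unfolding H_def by (intro square_integrable_mult_integrable square_integrable_truncated_exp h)
  have hH: "AE w in lborel. h w = H w"
    using supp by eventually_elim (auto simp: H_def truncated_exp_def indicator_def)
  have P_hol: "P holomorphic_on UNIV"
    unfolding P_def using B
    by (intro holomorphic_fourier_integral_compact_support[OF H, of B])
       (auto simp: H_def truncated_exp_def indicator_def)
  have kernel: "P z = of_real (sqrt (2 * pi)) * (\<integral>u. sinc_kernel B (z - of_real u) * ?g u \<partial>lborel)" for z
  proof -
    have "exp (\<i> * z * of_real w) * H w = truncated_exp B z w * h w" for w
      by (auto simp: H_def truncated_exp_def indicator_def)
    then have "P z = (\<integral>u. fourier_integral (truncated_exp B z) u * ?g u \<partial>lborel)"
      unfolding P_def
      using fourier_L2_pair_multiplication_formula[OF pair integrable_truncated_exp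
         square_integrable_truncated_exp square_integrable_fourier_truncated_exp[OF B]] by simp
    then show ?thesis by (simp only: fourier_integral_truncated_exp mult.assoc integral_mult_right_zero)
  qed
  have real: "sqrt (2 * pi) * ?g t = P (of_real t)" for t
  proof (rule LIMSEQ_unique)
    let ?s = "\<lambda>n. 1 / real (Suc n)"
    have "continuous_on UNIV ?g"
      by (intro continuous_on_compose2[OF holomorphic_on_imp_continuous_on[OF G]] continuous_intros) auto
    from tendsto_mult_left[OF normal_density_approximate_identity[OF this g], of "of_real (sqrt (2 * pi))" t]
    show "(\<lambda>n. of_real (sqrt (2 * pi)) * (\<integral>u. of_real (normal_density t (?s n) u) * ?g u \<partial>lborel))
       \<longlonglongrightarrow> sqrt (2 * pi) * ?g t" .
    have eq: "of_real (sqrt (2 * pi)) * (\<integral>u. of_real (normal_density t (?s n) u) * ?g u \<partial>lborel)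
      = (\<integral>w. gaussian_wave t (?s n) w * H w \<partial>lborel)" for n
    proof -
      have F: "fourier_integral (gaussian_wave t (?s n)) = (\<lambda>u. of_real (sqrt (2 * pi) * normal_density t (?s n) u))"
        by (rule ext, rule fourier_integral_gaussian_wave) simp
      have "(\<integral>w. gaussian_wave t (?s n) w * H w \<partial>lborel) = (\<integral>w. gaussian_wave t (?s n) w * h w \<partial>lborel)"
        using hH unfolding H_def by (intro integral_cong_AE) auto
      also have "\<dots> = (\<integral>u. fourier_integral (gaussian_wave t (?s n)) u * ?g u \<partial>lborel)"
      proof (intro fourier_L2_pair_multiplication_formula[OF pair] integrable_gaussian_wave square_integrable_gaussian_wave)
        show "square_integrable (fourier_integral (gaussian_wave t (?s n)))"
          unfolding F by (rule square_integrable_normal_density) simp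
      qed simp_all
      finally show ?thesis
        unfolding F integral_mult_right_zero[symmetric] by (simp add: mult_ac)
    qed
    have "(\<lambda>n. \<integral>w. gaussian_wave t (?s n) w * H w \<partial>lborel) \<longlonglongrightarrow> P (of_real t)"
      unfolding P_def
    proof (rule integral_dominated_convergence)
      show "integrable lborel (\<lambda>w. norm (H w))" using H by simp
      show "AE w in lborel. norm (gaussian_wave t (?s n) w * H w) \<le> norm (H w)" for n
        by (simp add: norm_mult norm_gaussian_wave mult_left_le_one_le)
      show "AE w in lborel. (\<lambda>n. gaussian_wave t (?s n) w * H w) \<longlonglongrightarrow> exp (\<i> * of_real t * of_real w) * H w"
      proof (intro AE_I2)
        fix w
        have lim: "?s \<longlonglongrightarrow> 0" by real_asymp
        have "(\<lambda>n. exp (- (?s n * w)\<^sup>2 / 2)) \<longlonglongrightarrow> exp (- (0 * w)\<^sup>2 / 2)"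
          by (intro tendsto_intros lim) simp
        then have "(\<lambda>n. exp (- (?s n * w)\<^sup>2 / 2)) \<longlonglongrightarrow> 1" by simp
        then have "(\<lambda>n. complex_of_real (exp (- (?s n * w)\<^sup>2 / 2))) \<longlonglongrightarrow> of_real 1" by (rule tendsto_of_real)
        from tendsto_mult[OF tendsto_const[of "iexp (t * w)"] this]
        have "(\<lambda>n. gaussian_wave t (?s n) w) \<longlonglongrightarrow> exp (\<i> * of_real t * of_real w)"
          by (simp add: gaussian_wave_def mult.assoc)
        then show "(\<lambda>n. gaussian_wave t (?s n) w * H w) \<longlonglongrightarrow> exp (\<i> * of_real t * of_real w) * H w"
          by (rule tendsto_mult_right)
      qed
    qed (auto simp: H_def)
    then show "(\<lambda>n. of_real (sqrt (2 * pi)) * (\<integral>u. of_real (normal_density t (?s n) u) * ?g u \<partial>lborel)) \<longlonglongrightarrow> P (of_real t)"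
      unfolding eq .
  qed
  have "sqrt (2 * pi) * G z - P z = 0"
  proof (rule analytic_continuation[of "\<lambda>z. sqrt (2 * pi) * G z - P z" UNIV "range of_real" 0])
    show "(\<lambda>z. sqrt (2 * pi) * G z - P z) holomorphic_on UNIV"
      using G P_hol by (intro holomorphic_intros)
    show "0 islimpt range complex_of_real"
      unfolding islimpt_sequential
    proof (intro exI conjI allI)
      let ?x = "\<lambda>n. complex_of_real (1 / real (Suc n))"
      show "?x n \<in> range complex_of_real - {0}" for n
        by (intro DiffI rangeI) (simp only: singleton_iff of_real_eq_0_iff, simp)
      have "(\<lambda>n. 1 / real (Suc n)) \<longlonglongrightarrow> 0" by real_asymp
      then show "?x \<longlonglongrightarrow> 0" using tendsto_of_real[where 'a = complex] by fastforce
    qed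
  qed (use real in auto)
  then have "of_real (sqrt (2 * pi)) * G z = of_real (sqrt (2 * pi)) * (\<integral>u. sinc_kernel B (z - of_real u) * ?g u \<partial>lborel)"
    by (simp only: kernel right_minus_eq)
  then have "G z = (\<integral>u. sinc_kernel B (z - of_real u) * ?g u \<partial>lborel)"
    by simp
  moreover have "integrable lborel (\<lambda>u. sinc_kernel B (z - of_real u) * ?g u)"
    using integrable_divide[OF square_integrable_mult_integrable[OF square_integrable_fourier_truncated_exp[OF B] g],
        of z "of_real (sqrt (2 * pi))"]
    by (simp add: fourier_integral_truncated_exp mult.assoc)
  ultimately show ?thesis
    by (simp add: has_bochner_integral_iff)
qed

text \<open>
  The complement of the support is a union of possibly uncountably many open sets on each of which
  \<open>h\<close> vanishes almost everywhere, but by Lindelof's theorem countably many of them cover it.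
\<close>

lemma AE_zero_outside_ess_support: "AE w in lborel. w \<notin> ess_support h \<longrightarrow> h w = 0"
proof -
  obtain F where F: "F \<subseteq> {V. open V \<and> (AE w in lborel. w \<in> V \<longrightarrow> h w = 0)}" "countable F"
    "\<Union>F = \<Union>{V. open V \<and> (AE w in lborel. w \<in> V \<longrightarrow> h w = 0)}"
    by (rule Lindelof[of "{V. open V \<and> (AE w in lborel. w \<in> V \<longrightarrow> h w = 0)}"]) auto
  have "AE w in lborel. \<forall>V\<in>F. w \<in> V \<longrightarrow> h w = 0"
    using F by (intro AE_ball_countable[THEN iffD2]) auto
  then show ?thesis
    unfolding ess_support_def F(3)[symmetric] by eventually_elim auto
qed

section \<open>Slices of the Clifford algebra as complex vector spaces\<close>

text \<open>Symmetrising the double sum for \<open>I * I\<close> leaves only the anticommutators of the generators.\<close>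

lemma unit_vector_square:
  fixes I :: "'n::{finite,linorder} clifford"
  assumes "I \<in> unit_vectors"
  shows "I * I = - 1"
proof -
  obtain v :: "'n \<Rightarrow> real" where v: "I = (\<Sum>i\<in>UNIV. v i *\<^sub>R gen i)" "(\<Sum>i\<in>UNIV. (v i)\<^sup>2) = 1"
    using assms by (auto simp: unit_vectors_def)
  have II: "I * I = (\<Sum>i\<in>UNIV. \<Sum>j\<in>UNIV. (v i * v j) *\<^sub>R (gen i * gen j))"
    unfolding v(1) sum_product by (intro sum.cong refl) (simp add: mult.commute)
  also have "\<dots> = (\<Sum>i\<in>UNIV. \<Sum>j\<in>UNIV. (v i * v j) *\<^sub>R (gen j * gen i))"
    by (rule trans[OF sum.swap]) (intro sum.cong refl arg_cong2[of _ _ _ _ scaleR] mult.commute)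
  finally have II': "I * I = (\<Sum>i\<in>UNIV. \<Sum>j\<in>UNIV. (v i * v j) *\<^sub>R (gen j * gen i))" .
  have "I * I + I * I = (\<Sum>i\<in>UNIV. \<Sum>j\<in>UNIV. (v i * v j) *\<^sub>R (gen i * gen j + gen j * gen i))"
    by (subst (1) II, subst II') (simp add: sum.distrib scaleR_add_right)
  also have "\<dots> = (\<Sum>i\<in>UNIV. \<Sum>j\<in>UNIV. if i = j then (v i)\<^sup>2 *\<^sub>R (- 2) else 0)"
    unfolding gen_anticommute by (intro sum.cong) (auto simp: power2_eq_square)
  also have "\<dots> = (\<Sum>i\<in>UNIV. (v i)\<^sup>2) *\<^sub>R (- 2)"
    by (simp add: scaleR_left.sum sum_negf)
  finally have "2 *\<^sub>R (I * I) = 2 *\<^sub>R (- 1)"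
    using v(2) by (simp add: scaleR_2)
  then show ?thesis
    by (metis scaleR_cancel_left zero_neq_numeral)
qed

text \<open>The identification of \<open>\<complex>\<close> with the slice \<open>\<real> + I \<real>\<close>; it is an algebra homomorphism when \<open>I * I = - 1\<close>.\<close>

definition slice_embed :: "'n::{finite,linorder} clifford \<Rightarrow> complex \<Rightarrow> 'n clifford" where
  "slice_embed I z = of_real (Re z) + I * of_real (Im z)"

lemma slice_embed_of_real [simp]: "slice_embed I (of_real t) = of_real t"
  by (simp add: slice_embed_def)

lemma slice_embed_1 [simp]: "slice_embed I 1 = 1"
  by (simp add: slice_embed_def)

lemma slice_embed_i [simp]: "slice_embed I \<i> = I"
  by (simp add: slice_embed_def)

lemma slice_embed_eq: "slice_embed I z = Re z *\<^sub>R 1 + Im z *\<^sub>R I"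
  by (simp add: slice_embed_def of_real_def)

lemma slice_embed_add: "slice_embed I (z + w) = slice_embed I z + slice_embed I w"
  by (simp add: slice_embed_def algebra_simps)

lemma slice_embed_scaleR: "slice_embed I (r *\<^sub>R z) = r *\<^sub>R slice_embed I z"
  by (simp add: slice_embed_eq scaleR_add_right)

lemma bounded_linear_slice_embed: "bounded_linear (slice_embed I)"
  by (intro linear_conv_bounded_linear[THEN iffD1] linearI) (simp_all add: slice_embed_add slice_embed_scaleR)

lemma slice_embed_mult:
  assumes "I \<in> unit_vectors"
  shows "slice_embed I (z * w) = slice_embed I z * slice_embed I w"
proof -
  have "slice_embed I z * slice_embed I w
    = (Re z * Re w) *\<^sub>R 1 + (Re z * Im w + Im z * Re w) *\<^sub>R I + (Im z * Im w) *\<^sub>R (I * I)"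
    unfolding slice_embed_eq by (simp add: distrib_left distrib_right scaleR_add_left scaleR_add_right mult.commute)
  also have "\<dots> = slice_embed I (z * w)"
    unfolding unit_vector_square[OF assms] slice_embed_eq by (simp add: scaleR_diff_left)
  finally show ?thesis ..
qed

lemma slice_embed_power:
  "I \<in> unit_vectors \<Longrightarrow> slice_embed I (z ^ k) = slice_embed I z ^ k"
  by (induction k) (simp_all add: slice_embed_mult)

text \<open>A continuous homomorphism commutes with the exponential series.\<close>

lemma clifford_exp_slice_embed:
  assumes "I \<in> unit_vectors"
  shows "clifford_exp (slice_embed I z) = slice_embed I (exp z)"
proof -
  have "(\<lambda>k. slice_embed I (z ^ k /\<^sub>R fact k)) sums slice_embed I (exp z)"
    by (intro bounded_linear.sums[OF bounded_linear_slice_embed] exp_converges)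
  then show ?thesis
    unfolding clifford_exp_def by (simp add: sums_iff slice_embed_scaleR slice_embed_power[OF assms])
qed

lemma slice_embed_in_paravectors:
  assumes "I \<in> unit_vectors"
  shows "slice_embed I z \<in> paravectors"
proof -
  obtain v where "I = (\<Sum>i\<in>UNIV. v i *\<^sub>R gen i)"
    using assms by (auto simp: unit_vectors_def)
  then have "slice_embed I z = of_real (Re z) + (\<Sum>i\<in>UNIV. (Im z * v i) *\<^sub>R gen i)"
    by (simp add: slice_embed_def of_real_def scaleR_sum_right)
  then show ?thesis unfolding paravectors_def by (intro CollectI exI conjI TrueI)
qed

lemma paravector_in_slice:
  fixes x :: "'n::{finite,linorder} clifford"
  assumes x: "x \<in> paravectors" and I: "I \<in> slice_units x"
  shows "I \<in> unit_vectors \<and> (\<exists>z. x = slice_embed I z)"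
proof (cases "x \<in> \<real>")
  case True
  then have "I \<in> unit_vectors" using I by (simp add: slice_units_def)
  moreover obtain r where "x = of_real r" using True by (auto elim: Reals_cases)
  ultimately show ?thesis by (metis slice_embed_of_real)
next
  case False
  obtain x0 and v :: "'n \<Rightarrow> real" where xv: "x = of_real x0 + (\<Sum>i\<in>UNIV. v i *\<^sub>R gen i)"
    using x by (auto simp: paravectors_def)
  define y :: "'n clifford" where "y = (\<Sum>i\<in>UNIV. v i *\<^sub>R gen i)"
  have coef_y: "coef y {i} = v i" for i
    by (simp add: y_def coef_blade if_distrib cong: if_cong)
  have "coef x {i} = v i" for i
    using coef_y[of i] unfolding xv y_def by (simp add: of_real_def one_clifford_def coef_blade)
  then have vx: "vector_part x = y" by (simp add: vector_part_def y_def)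
  have y0: "y \<noteq> 0" using False xv by (auto simp flip: y_def)
  have Ieq: "I = y /\<^sub>R norm y" using I False vx by (simp add: slice_units_def)
  have blade_inner: "inner (blade A) (blade B) = (if A = B then 1 else 0)" for A B :: "'n set"
  proof -
    have "inner (blade A) (blade B) = (\<Sum>C\<in>UNIV. if C = A then (if C = B then 1 else 0) else 0)"
      unfolding inner_clifford_def by (rule sum.cong) (auto simp: coef_blade)
    then show ?thesis by simp
  qed
  have norm_y: "(norm y)\<^sup>2 = (\<Sum>i\<in>UNIV. (v i)\<^sup>2)"
    unfolding power2_norm_eq_inner y_def
    by (simp add: inner_sum_left inner_sum_right blade_inner power2_eq_square if_distrib cong: if_cong)
  have "(\<Sum>i\<in>UNIV. (v i / norm y)\<^sup>2) = (norm y)\<^sup>2 / (norm y)\<^sup>2"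
    unfolding norm_y power_divide sum_divide_distrib ..
  then have "(\<Sum>i\<in>UNIV. (v i / norm y)\<^sup>2) = 1"
    using y0 by simp
  moreover have "I = (\<Sum>i\<in>UNIV. (v i / norm y) *\<^sub>R gen i)"
    unfolding Ieq by (simp add: y_def scaleR_sum_right divide_inverse_commute)
  ultimately have "I \<in> unit_vectors" unfolding unit_vectors_def
    by (intro CollectI exI[of _ "\<lambda>i. v i / norm y"]) (rule conjI)
  moreover have "x = slice_embed I (Complex x0 (norm y))"
    using y0 by (simp add: xv slice_embed_def Ieq of_real_def flip: y_def)
  ultimately show ?thesis by blast
qed

text \<open>
  A complex-valued coordinate functional, linear over \<open>\<complex>\<close> when the scalar \<open>\<i>\<close> acts as left multiplication
  by \<open>I\<close>: the imaginary part is forced by linearity once the real part is the coefficient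
  of \<open>A\<close>.
\<close>

definition slice_coef :: "'n::{finite,linorder} clifford \<Rightarrow> 'n set \<Rightarrow> 'n clifford \<Rightarrow> complex" where
  "slice_coef I A a = Complex (coef a A) (- coef (I * a) A)"

lemma Re_slice_coef [simp]: "Re (slice_coef I A a) = coef a A"
  by (simp add: slice_coef_def)

lemma bounded_linear_slice_coef: "bounded_linear (slice_coef I A)"
  by (intro linear_conv_bounded_linear[THEN iffD1] linearI)
     (simp_all add: slice_coef_def complex_eq_iff distrib_left)

lemma slice_coef_add: "slice_coef I A (a + b) = slice_coef I A a + slice_coef I A b"
  and slice_coef_scaleR: "slice_coef I A (r *\<^sub>R a) = r *\<^sub>R slice_coef I A a"
  by (simp_all add: slice_coef_def complex_eq_iff distrib_left)

lemma slice_coef_unit_mult: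
  assumes "I \<in> unit_vectors"
  shows "slice_coef I A (I * a) = \<i> * slice_coef I A a"
  unfolding slice_coef_def mult.assoc[symmetric] unit_vector_square[OF assms]
  by (simp add: complex_eq_iff)

lemma slice_coef_embed_mult:
  assumes "I \<in> unit_vectors"
  shows "slice_coef I A (slice_embed I z * a) = z * slice_coef I A a"
proof -
  have "slice_embed I z * a = Re z *\<^sub>R a + Im z *\<^sub>R (I * a)"
    by (simp add: slice_embed_eq distrib_right)
  then have "slice_coef I A (slice_embed I z * a) = Re z *\<^sub>R slice_coef I A a + Im z *\<^sub>R (\<i> * slice_coef I A a)"
    by (simp add: slice_coef_add slice_coef_scaleR slice_coef_unit_mult[OF assms])
  then show ?thesis
    by (simp add: complex_eq_iff)
qed

text \<open>
  A slice monogenic function satisfies, along the slice, the Cauchy--Riemann equation with \<open>I\<close> in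
  the role of the imaginary unit; the complex linear functional turns it into the ordinary
  equation, so the real derivative is complex linear.
\<close>

lemma holomorphic_slice_coef:
  fixes f :: "'n::{finite,linorder} clifford \<Rightarrow> 'n clifford"
  assumes f: "f \<in> slice_monogenic paravectors" and I: "I \<in> unit_vectors"
  shows "(\<lambda>z. slice_coef I A (f (slice_embed I z))) holomorphic_on UNIV"
proof -
  have "\<exists>c. ((\<lambda>z. slice_coef I A (f (slice_embed I z))) has_field_derivative c) (at z)" for z
  proof -
    let ?F = "\<lambda>z. f (slice_embed I z)"
    have "f differentiable (at (slice_embed I z) within paravectors)"
      using f slice_embed_in_paravectors[OF I] by (auto simp: slice_monogenic_def differentiable_on_def)
    then obtain D where D: "(f has_derivative D) (at (slice_embed I z) within paravectors)"
      by (auto simp: differentiable_def)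
    define D' where "D' = (\<lambda>h. D (slice_embed I h))"
    have F: "(?F has_derivative D') (at z)"
      unfolding D'_def
      by (rule has_derivative_in_compose[OF bounded_linear_imp_has_derivative[OF bounded_linear_slice_embed]
            has_derivative_subset[OF D]])
         (use slice_embed_in_paravectors[OF I] in auto)
    interpret D': bounded_linear D' using F by (rule has_derivative_bounded_linear)
    \<comment> \<open>Both partial derivatives are directional derivatives, in the directions \<open>1\<close> and \<open>\<i>\<close>.\<close>
    have partial: "((\<lambda>s. ?F (w + of_real s * d)) has_vector_derivative D' d) (at s)"
      if "w + of_real s * d = z" for w d s
    proof -
      have "((\<lambda>s. w + of_real s * d) has_derivative (\<lambda>h. of_real h * d)) (at s)"
        by (auto intro!: derivative_eq_intros)
      from has_derivative_compose[OF this, of ?F D'] F that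
      show ?thesis by (simp add: has_vector_derivative_def D'.scaleR flip: scaleR_conv_of_real)
    qed
    have "((\<lambda>s. ?F (\<i> * of_real (Im z) + of_real s * 1)) has_vector_derivative D' 1) (at (Re z))"
      by (rule partial) (simp add: complex_eq_iff)
    moreover have "?F (\<i> * of_real (Im z) + of_real s * 1) = f (of_real s + I * of_real (Im z))" for s
      by (simp add: slice_embed_def)
    ultimately have u: "vector_derivative (\<lambda>s. f (of_real s + I * of_real (Im z))) (at (Re z)) = D' 1"
      by (simp add: vector_derivative_at)
    have "((\<lambda>t. ?F (of_real (Re z) + of_real t * \<i>)) has_vector_derivative D' \<i>) (at (Im z))"
      by (rule partial) (simp add: complex_eq_iff)
    moreover have "?F (of_real (Re z) + of_real t * \<i>) = f (of_real (Re z) + I * of_real t)" for t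
      by (simp add: slice_embed_def)
    ultimately have v: "vector_derivative (\<lambda>t. f (of_real (Re z) + I * of_real t)) (at (Im z)) = D' \<i>"
      by (simp add: vector_derivative_at)
    have "of_real (Re z) + I * of_real (Im z) \<in> paravectors"
      using slice_embed_in_paravectors[OF I, of z] by (simp add: slice_embed_def)
    then have "(D' 1 + I * D' \<i>) /\<^sub>R 2 = 0"
      using f I u v unfolding slice_monogenic_def by fastforce
    then have "D' 1 + I * D' \<i> = 0" by simp
    from arg_cong[OF this, of "slice_coef I A"]
    have "slice_coef I A (D' 1) + \<i> * slice_coef I A (D' \<i>) = 0"
      by (simp add: slice_coef_add slice_coef_unit_mult[OF I] linear_0[OF bounded_linear.linear[OF bounded_linear_slice_coef]])
    then have CR: "slice_coef I A (D' \<i>) = \<i> * slice_coef I A (D' 1)"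
      by (simp add: complex_eq_iff)
    have D'_eq: "D' h = Re h *\<^sub>R D' 1 + Im h *\<^sub>R D' \<i>" for h
      unfolding D'.scaleR[symmetric] D'.add[symmetric] by (rule arg_cong[of _ _ D']) (simp add: complex_eq_iff)
    have "(\<lambda>h. slice_coef I A (D' h)) = (*) (slice_coef I A (D' 1))"
      by (rule ext, subst D'_eq) (simp add: slice_coef_add slice_coef_scaleR CR complex_eq_iff)
    with bounded_linear.has_derivative[OF bounded_linear_slice_coef[of I A] F] show ?thesis
      unfolding has_field_derivative_def by (intro exI[of _ "slice_coef I A (D' 1)"]) simp
  qed
  then show ?thesis
    by (auto simp: holomorphic_on_def field_differentiable_def)
qed

section \<open>Transfer to the Clifford algebra\<close>

lemma has_bochner_integral_cliffordI:
  fixes g :: "'a \<Rightarrow> 'n::{finite,linorder} clifford"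
  assumes "\<And>A. has_bochner_integral M (\<lambda>x. coef (g x) A) (coef c A)"
  shows "has_bochner_integral M g c"
proof -
  have expand: "a = (\<Sum>A\<in>UNIV. coef a A *\<^sub>R blade A)" for a :: "'n clifford"
    by (rule clifford_eqI) (simp add: coef_blade mult_delta_right)
  have "has_bochner_integral M (\<lambda>x. \<Sum>A\<in>UNIV. coef (g x) A *\<^sub>R blade A) (\<Sum>A\<in>UNIV. coef c A *\<^sub>R blade A)"
    by (intro has_bochner_integral_sum has_bochner_integral_scaleR_left assms)
  then show ?thesis by (simp flip: expand)
qed

lemma borel_measurable_bounded_linear:
  assumes T: "bounded_linear T" and g: "g \<in> borel_measurable M"
  shows "(\<lambda>t. T (g t)) \<in> borel_measurable M"
  by (rule measurable_compose[OF g borel_measurable_continuous_onI[OF linear_continuous_on[OF T]]])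

lemma square_integrable_bounded_linear:
  assumes T: "bounded_linear T" and g: "square_integrable g"
  shows "square_integrable (\<lambda>t. T (g t))"
proof -
  obtain K where K: "\<And>x. norm (T x) \<le> norm x * K" "K \<ge> 0"
    using bounded_linear.nonneg_bounded[OF T] by blast
  have [measurable]: "g \<in> borel_measurable borel" using g by (simp add: square_integrable_def)
  have meas [measurable]: "(\<lambda>t. T (g t)) \<in> borel_measurable borel"
    by (rule borel_measurable_bounded_linear[OF T]) simp
  have "integrable lborel (\<lambda>t. (norm (T (g t)))\<^sup>2)"
  proof (rule Bochner_Integration.integrable_bound)
    show "integrable lborel (\<lambda>t. (norm (g t))\<^sup>2 * K\<^sup>2)" using g by (simp add: square_integrable_def)
    have "(norm (T x))\<^sup>2 \<le> (norm x)\<^sup>2 * K\<^sup>2" for x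
      using power_mono[OF K(1) norm_ge_zero, of x 2] by (simp add: power_mult_distrib)
    then show "AE t in lborel. norm ((norm (T (g t)))\<^sup>2) \<le> norm ((norm (g t))\<^sup>2 * K\<^sup>2)" by simp
  qed measurable
  then show ?thesis using meas by (simp add: square_integrable_def)
qed

lemma L2_tendsto_bounded_linear:
  assumes T: "bounded_linear T" and G: "L2_tendsto G g"
    and meas: "\<And>k. G k \<in> borel_measurable borel" "g \<in> borel_measurable borel"
  shows "L2_tendsto (\<lambda>k t. T (G k t)) (\<lambda>t. T (g t))"
proof -
  interpret T: bounded_linear T by fact
  obtain K where K: "\<And>x. norm (T x) \<le> norm x * K" "K \<ge> 0"
    using T.nonneg_bounded by blast
  let ?I = "\<lambda>k. \<integral>\<^sup>+t. ennreal ((norm (G k t - g t))\<^sup>2) \<partial>lborel"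
  have bound: "(\<integral>\<^sup>+t. ennreal ((norm (T (G k t) - T (g t)))\<^sup>2) \<partial>lborel) \<le> ennreal (K\<^sup>2) * ?I k" for k
  proof -
    note [measurable] = meas
    have "(norm (T (G k t) - T (g t)))\<^sup>2 \<le> K\<^sup>2 * (norm (G k t - g t))\<^sup>2" for t
      using power_mono[OF K(1) norm_ge_zero, of "G k t - g t" 2]
      by (simp add: T.diff power_mult_distrib mult.commute)
    then have "(\<integral>\<^sup>+t. ennreal ((norm (T (G k t) - T (g t)))\<^sup>2) \<partial>lborel)
        \<le> (\<integral>\<^sup>+t. ennreal (K\<^sup>2) * ennreal ((norm (G k t - g t))\<^sup>2) \<partial>lborel)"
      by (intro nn_integral_mono) (simp flip: ennreal_mult)
    also have "\<dots> = ennreal (K\<^sup>2) * ?I k"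
      by (rule nn_integral_cmult) measurable
    finally show ?thesis .
  qed
  have "(\<lambda>k. ennreal (K\<^sup>2) * ?I k) \<longlonglongrightarrow> ennreal (K\<^sup>2) * 0"
    using G unfolding L2_tendsto_def by (intro ennreal_tendsto_cmult) auto
  then have lim: "(\<lambda>k. ennreal (K\<^sup>2) * ?I k) \<longlonglongrightarrow> 0" by simp
  show ?thesis
    unfolding L2_tendsto_def
    by (rule tendsto_sandwich[OF _ _ tendsto_const lim]) (simp_all add: bound)
qed

text \<open>
  Written in this form, products with elements of the slice come within reach of the measurability
  and integrability rules for real scalar multiples and bounded linear maps.
\<close>

lemma slice_embed_mult_eq: "slice_embed I z * a = Re z *\<^sub>R a + Im z *\<^sub>R (I * a)"
  by (simp add: slice_embed_eq distrib_right)

lemma fourier_eq_slice_embed: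
  assumes "I \<in> unit_vectors"
  shows "fourier I g w = (1 / sqrt (2 * pi)) *\<^sub>R
     (\<integral>u. slice_embed I (exp (- (\<i> * of_real u * of_real w))) * g u \<partial>lborel)"
proof -
  have "- (I * of_real u * of_real w) = slice_embed I (- (\<i> * of_real u * of_real w))" for u
    by (simp add: slice_embed_def mult.assoc)
  then show ?thesis
    by (simp add: fourier_def clifford_exp_slice_embed[OF assms])
qed

lemma bounded_linear_clifford_mult_right: "bounded_linear (\<lambda>a :: 'n::{finite,linorder} clifford. b * a)"
  by (intro linear_conv_bounded_linear[THEN iffD1] linearI) (simp_all add: distrib_left)

lemma borel_measurable_fourier:
  assumes I: "I \<in> unit_vectors" and [measurable]: "g \<in> borel_measurable borel"
  shows "fourier I g \<in> borel_measurable borel"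
proof -
  have [measurable]: "(\<lambda>u. I * g u) \<in> borel_measurable borel"
    by (rule borel_measurable_bounded_linear[OF bounded_linear_clifford_mult_right]) simp
  show ?thesis
    unfolding fourier_eq_slice_embed[OF I, abs_def] slice_embed_mult_eq by measurable
qed

text \<open>
  The functional is bounded, hence passes under the integral, and is linear over the slice, hence
  takes the Clifford exponential out as a complex factor.
\<close>

lemma slice_coef_fourier:
  fixes g :: "real \<Rightarrow> 'n::{finite,linorder} clifford"
  assumes I: "I \<in> unit_vectors" and g: "integrable lborel g"
  shows "slice_coef I A (fourier I g w) = fourier_integral (\<lambda>t. slice_coef I A (g t)) w"
proof -
  let ?e = "\<lambda>u. exp (- (\<i> * of_real u * of_real w))"
  have bounded_mult: "integrable lborel (\<lambda>u. c u *\<^sub>R k u)"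
    if "integrable lborel k" "c \<in> borel_measurable borel" "\<And>u. \<bar>c u\<bar> \<le> 1"
    for c :: "real \<Rightarrow> real" and k :: "real \<Rightarrow> 'n clifford"
    by (rule Bochner_Integration.integrable_bound[OF that(1)])
       (use that in \<open>auto simp: mult_left_le_one_le intro!: AE_I2\<close>)
  have int: "integrable lborel (\<lambda>u. slice_embed I (?e u) * g u)"
    unfolding slice_embed_mult_eq
  proof (intro Bochner_Integration.integrable_add bounded_mult g
      integrable_bounded_linear[OF bounded_linear_clifford_mult_right g])
    show "\<bar>Re (?e u)\<bar> \<le> 1" "\<bar>Im (?e u)\<bar> \<le> 1" for u
      using abs_Re_le_cmod[of "?e u"] abs_Im_le_cmod[of "?e u"] by simp_all
  qed measurable
  show ?thesis
    unfolding fourier_eq_slice_embed[OF I] fourier_integral_def slice_coef_scaleR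
      integral_bounded_linear[OF bounded_linear_slice_coef int, symmetric] slice_coef_embed_mult[OF I]
    by (simp add: scaleR_conv_of_real)
qed

lemma fourier_L2_pair_slice_coef:
  assumes I: "I \<in> unit_vectors" and gh: "has_fourier_L2 I g h"
  shows "fourier_L2_pair (\<lambda>t. slice_coef I A (g t)) (\<lambda>t. slice_coef I A (h t))"
proof -
  obtain G where G: "\<And>k. integrable lborel (G k)" "\<And>k. square_integrable (G k)"
    "L2_tendsto G g" "L2_tendsto (\<lambda>k. fourier I (G k)) h"
    using gh unfolding has_fourier_L2_def by auto
  note T = bounded_linear_slice_coef[of I A]
  have meas: "g \<in> borel_measurable borel" "h \<in> borel_measurable borel" "G k \<in> borel_measurable borel" for k
    using gh G(2)[of k] by (auto simp: has_fourier_L2_def square_integrable_def)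
  have "L2_tendsto (\<lambda>k. fourier_integral (\<lambda>t. slice_coef I A (G k t))) (\<lambda>t. slice_coef I A (h t))"
    using L2_tendsto_bounded_linear[OF T G(4) borel_measurable_fourier[OF I meas(3)] meas(2)] unfolding slice_coef_fourier[OF I G(1)] .
  moreover have "integrable lborel (\<lambda>t. slice_coef I A (G k t))" for k
    by (rule integrable_bounded_linear[OF T G(1)])
  ultimately show ?thesis
    unfolding fourier_L2_pair_def
    using gh G L2_tendsto_bounded_linear[OF T G(3) meas(3,1)]
    by (intro conjI exI[of _ "\<lambda>k t. slice_coef I A (G k t)"] allI square_integrable_bounded_linear[OF T])
       (auto simp: has_fourier_L2_def)
qed

lemma pw_kernel_slice_embed:
  assumes I: "I \<in> unit_vectors"
  shows "pw_kernel B I (slice_embed I z) \<xi> = slice_embed I (sinc_kernel B (z - of_real \<xi>))"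
proof -
  have sinc_eq: "sinc_kernel B y = (1 / (2 * pi)) *\<^sub>R (\<integral>w. truncated_exp B y w \<partial>lborel)" for y
    by (simp add: sinc_kernel_def scaleR_conv_of_real)
  have "indicator {- B..B} w *\<^sub>R clifford_exp (I * (slice_embed I z - of_real \<xi>) * of_real w)
      = slice_embed I (truncated_exp B (z - of_real \<xi>) w)" for w
  proof -
    have "I * (slice_embed I z - of_real \<xi>) * of_real w = slice_embed I (\<i> * (z - of_real \<xi>) * of_real w)"
      unfolding slice_embed_mult[OF I] slice_embed_i slice_embed_of_real
      by (simp add: linear_diff[OF bounded_linear.linear[OF bounded_linear_slice_embed]])
    then show ?thesis
      by (simp add: clifford_exp_slice_embed[OF I] truncated_exp_def slice_embed_scaleR)
  qed
  then have "pw_kernel B I (slice_embed I z) \<xi>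
     = (1 / (2 * pi)) *\<^sub>R slice_embed I (\<integral>w. truncated_exp B (z - of_real \<xi>) w \<partial>lborel)"
    unfolding pw_kernel_def set_lebesgue_integral_def
    by (simp add: integral_bounded_linear[OF bounded_linear_slice_embed integrable_truncated_exp])
  then show ?thesis
    by (simp add: sinc_eq slice_embed_scaleR)
qed

theorem corollary3p15:
  fixes B :: real and f :: "'n::{finite,linorder} clifford \<Rightarrow> 'n clifford"
  assumes "B > 0" and "f \<in> paley_wiener B"
  shows "\<forall>x\<in>paravectors. \<forall>I\<in>slice_units x.
    has_bochner_integral lborel (\<lambda>\<xi>. pw_kernel B I x \<xi> * f (of_real \<xi>)) (f x)"
proof (intro ballI)
  fix x I :: "'n clifford"
  assume "x \<in> paravectors" "I \<in> slice_units x"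
  then obtain z where I: "I \<in> unit_vectors" and x: "x = slice_embed I z"
    using paravector_in_slice by blast
  have f: "f \<in> slice_monogenic paravectors"
    using assms(2) by (simp add: paley_wiener_def)
  obtain h where h: "has_fourier_L2 I (\<lambda>t. f (of_real t)) h" "ess_support h \<subseteq> {- B..B}"
    using assms(2) I by (auto simp: paley_wiener_def)
  show "has_bochner_integral lborel (\<lambda>\<xi>. pw_kernel B I x \<xi> * f (of_real \<xi>)) (f x)"
  proof (rule has_bochner_integral_cliffordI)
    fix A
    let ?G = "\<lambda>z. slice_coef I A (f (slice_embed I z))"
    have "fourier_L2_pair (\<lambda>t. ?G (of_real t)) (\<lambda>w. slice_coef I A (h w))"
      using fourier_L2_pair_slice_coef[OF I h(1)] by simp
    moreover have "AE w in lborel. w \<notin> {- B..B} \<longrightarrow> slice_coef I A (h w) = 0"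
      using AE_zero_outside_ess_support[of h]
    proof eventually_elim
      case (elim w)
      then show ?case
        using h(2) linear_0[OF bounded_linear.linear[OF bounded_linear_slice_coef, of I A]] by auto
    qed
    ultimately have "has_bochner_integral lborel (\<lambda>u. sinc_kernel B (z - of_real u) * ?G (of_real u)) (?G z)"
      by (intro paley_wiener_reproducing_complex assms(1) holomorphic_slice_coef[OF f I])
    from has_bochner_integral_Re[OF this]
    show "has_bochner_integral lborel (\<lambda>\<xi>. coef (pw_kernel B I x \<xi> * f (of_real \<xi>)) A) (coef (f x) A)"
      by (simp add: x pw_kernel_slice_embed[OF I] flip: slice_coef_embed_mult[OF I])
  qed
qed

end
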